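(* Let $m$ be an even number and let $\mathcal{A}$ be a real symmetric extended $Z$-tensor of order $m$ and dimension $n$. Then $$\lambda_{\min}(\mathcal{A})=\max_{\mu,r\in\mathbb{R}}\{\mu: f_{\mathcal{A}}(\mathbf{x})-r(\|\mathbf{x}\|_m^m-1)-\mu\in\Sigma_m^2[\mathbf{x}]\},$$ where $f_{\mathcal{A}}(\mathbf{x})=\mathcal{A}\mathbf{x}^m$ and $\Sigma_m^2[\mathbf{x}]$ is the set of all SOS polynomials with degree at most $m$.
   Context: A real tensor of order $m$ and dimension $n$ is an array $\mathcal{A}=(a_{i_1\cdots i_m})$ with $i_1,\dots,i_m\in[n]=\{1,\dots,n\}$; it is symmetric if its entries are invariant under permutations of the indices. $\mathcal{A}\mathbf{x}^m=\sum_{i_1,\dots,i_m\in[n]}a_{i_1\cdots i_m}x_{i_1}\cdots x_{i_m}$ for $\mathbf{x}\in\mathbb{R}^n$. SOS polynomials are finite sums of squares of real polynomials. $\|\mathbf{x}\|_m=(\sum_{i=1}^n|x_i|^m)^{1/m}$. A real number $\lambda$ is an $H$-eigenvalue of $\mathcal{A}$ if there is $\mathbf{x}\in\mathbb{R}^n\setminus\{0\}$ with $\sum_{i_2,\dots,i_m=1}^n a_{ii_2\cdots i_m}x_{i_2}\cdots x_{i_m}=\lambda x_i^{m-1}$ for all $i\in[n]$; $\lambda_{\min}(\mathcal{A})$ denotes the minimum $H$-eigenvalue of $\mathcal{A}$. A polynomial $f$ of degree $m$ on $\mathbb{R}^n$ is an extended $Z$-polynomial if there exist $s\in\mathbb{N}$,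 $s\le n$, and index sets $\Gamma_1,\dots,\Gamma_s\subseteq[n]$ with $\bigcup_{l=1}^s\Gamma_l=[n]$ and $\Gamma_{l_1}\cap\Gamma_{l_2}=\emptyset$ for $l_1\ne l_2$, such that $f(\mathbf{x})=\sum_{i=1}^n f_{m,i}x_i^m+\sum_{l=1}^s\sum_{\alpha_l\in\Omega_l}f_{\alpha_l}\mathbf{x}^{\alpha_l}$, where $f_{m,i}$ is the coefficient of $x_i^m$ in $f$, $\Omega_l$ is the set of $\alpha\in(\mathbb{N}\cup\{0\})^n$ with $|\alpha|=m$, $\mathbf{x}^\alpha=x_{i_1}\cdots x_{i_m}$ with $\{i_1,\dots,i_m\}\subseteq\Gamma_l$, and $\alpha\ne m\,\mathbf{e}_i$ for all $i$ ($\mathbf{e}_i$ the $i$th unit vector), and for each $l=1,\dots,s$ one of the following holds: (1) $f_{\alpha_l}=0$ for all but one $\alpha_l\in\Omega_l$; (2) $f_{\alpha_l}\le0$ for all $\alpha_l\in\Omega_l$. A symmetric tensor $\mathcal{A}$ is an extended $Z$-tensor if $f_{\mathcal{A}}$ is an extended $Z$-polynomial. *)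

theory Defs
  imports
    "HOL-Analysis.Analysis"
    "HOL-Library.Poly_Mapping"
    "HOL-Combinatorics.Permutations"
begin

section \<open>Real polynomials in the variables indexed by a finite type\<close>

text \<open>
  The finite index type \<^typ>\<open>'n\<close> plays the role of \<open>[n]\<close>. Exponent vectors and polynomials are
  finitely supported functions, so that the ring operations on polynomials are those of
  \<^theory>\<open>HOL-Library.Poly_Mapping\<close> (multiplication is convolution).
\<close>

type_synonym 'n mpolynomial = "('n \<Rightarrow>\<^sub>0 nat) \<Rightarrow>\<^sub>0 real"

definition Const :: "real \<Rightarrow> 'n mpolynomial" where
  "Const c = Poly_Mapping.single 0 c"

definition Var :: "'n \<Rightarrow> 'n mpolynomial" where
  "Var i = Poly_Mapping.single (Poly_Mapping.single i 1) 1"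

definition mdegree :: "('n::finite \<Rightarrow>\<^sub>0 nat) \<Rightarrow> nat" where
  "mdegree \<alpha> = (\<Sum>i\<in>UNIV. Poly_Mapping.lookup \<alpha> i)"

text \<open>The zero polynomial gets degree 0.\<close>

definition poly_degree :: "'n::finite mpolynomial \<Rightarrow> nat" where
  "poly_degree p = Max (insert 0 (mdegree ` Poly_Mapping.keys p))"

definition poly_eval :: "'n::finite mpolynomial \<Rightarrow> real ^ 'n \<Rightarrow> real" where
  "poly_eval p x =
     (\<Sum>\<alpha>\<in>Poly_Mapping.keys p. Poly_Mapping.lookup p \<alpha> * (\<Prod>i\<in>UNIV. (x $ i) ^ Poly_Mapping.lookup \<alpha> i))"

definition SOS :: "nat \<Rightarrow> 'n::finite mpolynomial set" where
  "SOS d = {p. poly_degree p \<le> d \<and>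
               (\<exists>(k::nat) (q :: nat \<Rightarrow> 'n mpolynomial). p = (\<Sum>j<k. (q j)\<^sup>2))}"


definition is_minimum :: "real set \<Rightarrow> real \<Rightarrow> bool" where
  "is_minimum S a \<longleftrightarrow> a \<in> S \<and> (\<forall>b\<in>S. a \<le> b)"

definition is_maximum :: "real set \<Rightarrow> real \<Rightarrow> bool" where
  "is_maximum S a \<longleftrightarrow> a \<in> S \<and> (\<forall>b\<in>S. b \<le> a)"


section \<open>Tensors\<close>

text \<open>
  A tensor of order \<open>m\<close> assigns a real to each index list of length \<open>m\<close>; its values at lists of
  other lengths are never used.
\<close>

type_synonym 'n tensor = "'n list \<Rightarrow> real"

definition symmetric_tensor :: "nat \<Rightarrow> 'n tensor \<Rightarrow> bool" where
  "symmetric_tensor m A \<longleftrightarrow>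
     (\<forall>is \<sigma>. length is = m \<longrightarrow> \<sigma> permutes {..<m} \<longrightarrow> A (permute_list \<sigma> is) = A is)"

definition tensor_form :: "nat \<Rightarrow> 'n::finite tensor \<Rightarrow> real ^ 'n \<Rightarrow> real" where
  "tensor_form m A x = (\<Sum>is | length is = m. A is * prod_list (map (\<lambda>i. x $ i) is))"

definition tensor_poly :: "nat \<Rightarrow> 'n::finite tensor \<Rightarrow> 'n mpolynomial" where
  "tensor_poly m A = (\<Sum>is | length is = m. Const (A is) * prod_list (map Var is))"

definition H_eigenvalue :: "nat \<Rightarrow> 'n::finite tensor \<Rightarrow> real \<Rightarrow> bool" where
  "H_eigenvalue m A l \<longleftrightarrow>
     (\<exists>x :: real ^ 'n. x \<noteq> 0 \<and>
        (\<forall>i. (\<Sum>is | length is = m - 1. A (i # is) * prod_list (map (\<lambda>j. x $ j) is))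
               = l * (x $ i) ^ (m - 1)))"

definition lambda_min :: "nat \<Rightarrow> 'n::finite tensor \<Rightarrow> real" where
  "lambda_min m A = (LEAST l. H_eigenvalue m A l)"

definition m_norm :: "nat \<Rightarrow> real ^ 'n::finite \<Rightarrow> real" where
  "m_norm m x = root m (\<Sum>i\<in>UNIV. \<bar>x $ i\<bar> ^ m)"

text \<open>
  The polynomial which, for even \<open>m > 0\<close>, represents the \<open>m\<close>-th power of the \<open>m\<close>-norm; see
  \<open>poly_eval_m_norm_poly\<close> below.
\<close>

definition m_norm_poly :: "nat \<Rightarrow> 'n::finite mpolynomial" where
  "m_norm_poly m = (\<Sum>i\<in>UNIV. Var i ^ m)"


section \<open>Extended Z-polynomials and extended Z-tensors\<close>

definition Omega :: "nat \<Rightarrow> 'n::finite set \<Rightarrow> ('n \<Rightarrow>\<^sub>0 nat) set" where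
  "Omega m \<Gamma> = {\<alpha>. mdegree \<alpha> = m \<and> Poly_Mapping.keys \<alpha> \<subseteq> \<Gamma> \<and>
                    (\<forall>i. \<alpha> \<noteq> Poly_Mapping.single i m)}"

text \<open>
  The displayed shape forces every monomial of \<open>f\<close> to have degree \<open>m\<close>. The zero polynomial is
  admitted as a form of degree \<open>m\<close>, so that the zero tensor is not excluded.
\<close>

definition extended_Z_polynomial :: "nat \<Rightarrow> 'n::finite mpolynomial \<Rightarrow> bool" where
  "extended_Z_polynomial m f \<longleftrightarrow>
     (\<exists>s \<Gamma>. s \<le> CARD('n) \<and>
        (\<Union>l\<in>{1..s}. \<Gamma> l) = (UNIV :: 'n set) \<and>
        (\<forall>l1\<in>{1..s}. \<forall>l2\<in>{1..s}. l1 \<noteq> l2 \<longrightarrow> \<Gamma> l1 \<inter> \<Gamma> l2 = {}) \<and>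
        f = (\<Sum>i\<in>UNIV. Const (Poly_Mapping.lookup f (Poly_Mapping.single i m)) * Var i ^ m)
            + (\<Sum>l\<in>{1..s}. \<Sum>\<alpha>\<in>Omega m (\<Gamma> l). Poly_Mapping.single \<alpha> (Poly_Mapping.lookup f \<alpha>)) \<and>
        (\<forall>l\<in>{1..s}.
           (\<exists>\<beta>\<in>Omega m (\<Gamma> l). \<forall>\<alpha>\<in>Omega m (\<Gamma> l) - {\<beta>}. Poly_Mapping.lookup f \<alpha> = 0) \<or>
           (\<forall>\<alpha>\<in>Omega m (\<Gamma> l). Poly_Mapping.lookup f \<alpha> \<le> 0)))"

definition extended_Z_tensor :: "nat \<Rightarrow> 'n::finite tensor \<Rightarrow> bool" where
  "extended_Z_tensor m A \<longleftrightarrow> symmetric_tensor m A \<and> extended_Z_polynomial m (tensor_poly m A)"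


section \<open>The polynomials above represent the intended functions\<close>

lemma finite_Omega: "finite (Omega m \<Gamma> :: ('n::finite \<Rightarrow>\<^sub>0 nat) set)"
proof -
  have "inj_on Poly_Mapping.lookup (Omega m \<Gamma>)"
    by (auto intro!: inj_onI poly_mapping_eqI)
  moreover have "Poly_Mapping.lookup ` Omega m \<Gamma> \<subseteq> {g :: 'n \<Rightarrow> nat. \<forall>i. g i \<le> m}"
  proof safe
    fix \<alpha> :: "'n \<Rightarrow>\<^sub>0 nat" and i
    assume "\<alpha> \<in> Omega m \<Gamma>"
    then have "mdegree \<alpha> = m" by (simp add: Omega_def)
    then show "Poly_Mapping.lookup \<alpha> i \<le> m"
      unfolding mdegree_def by (metis UNIV_I finite_class.finite_UNIV member_le_sum zero_le)
  qed
  moreover have "finite {g :: 'n \<Rightarrow> nat. \<forall>i. g i \<le> m}"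
  proof -
    have "{g :: 'n \<Rightarrow> nat. \<forall>i. g i \<le> m} = Pi\<^sub>E UNIV (\<lambda>_. {..m})"
      by (auto simp: PiE_def)
    then show ?thesis by (simp add: finite_PiE)
  qed
  ultimately show ?thesis
    by (meson finite_imageD finite_subset)
qed

lemma poly_eval_superset:
  assumes "finite K" "Poly_Mapping.keys p \<subseteq> K"
  shows "poly_eval p x =
    (\<Sum>\<alpha>\<in>K. Poly_Mapping.lookup p \<alpha> * (\<Prod>i\<in>UNIV. (x $ i) ^ Poly_Mapping.lookup \<alpha> i))"
  unfolding poly_eval_def
  by (rule sum.mono_neutral_left) (use assms in \<open>auto simp: in_keys_iff\<close>)

lemma poly_eval_0 [simp]: "poly_eval 0 x = 0"
  by (simp add: poly_eval_def)

lemma poly_eval_single: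
  "poly_eval (Poly_Mapping.single \<alpha> c) x = c * (\<Prod>i\<in>UNIV. (x $ i) ^ Poly_Mapping.lookup \<alpha> i)"
  by (subst poly_eval_superset[of "{\<alpha>}"]) auto

lemma poly_eval_add: "poly_eval (p + q) x = poly_eval p x + poly_eval q x"
proof -
  let ?K = "Poly_Mapping.keys p \<union> Poly_Mapping.keys q"
  have "Poly_Mapping.keys (p + q) \<subseteq> ?K" by (rule Poly_Mapping.keys_add)
  then show ?thesis
    by (subst (1 2 3) poly_eval_superset[of ?K])
       (auto simp: lookup_add algebra_simps sum.distrib)
qed

lemma poly_eval_sum: "poly_eval (sum f S) x = (\<Sum>s\<in>S. poly_eval (f s) x)"
  by (induction S rule: infinite_finite_induct) (auto simp: poly_eval_add)

lemma poly_eval_uminus: "poly_eval (- p) x = - poly_eval p x"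
  using poly_eval_add[of p "- p" x] by simp

lemma poly_eval_diff: "poly_eval (p - q) x = poly_eval p x - poly_eval q x"
  using poly_eval_add[of p "- q" x] by (simp add: poly_eval_uminus)

lemma poly_eval_mult: "poly_eval (p * q) x = poly_eval p x * poly_eval q x"
proof -
  have dec: "r = (\<Sum>\<alpha>\<in>Poly_Mapping.keys r. Poly_Mapping.single \<alpha> (Poly_Mapping.lookup r \<alpha>))"
    for r :: "'a mpolynomial"
    by (rule poly_mapping_eqI)
       (auto simp: lookup_sum lookup_single when_def in_keys_iff sum.delta)
  have "p * q = (\<Sum>\<alpha>\<in>Poly_Mapping.keys p. \<Sum>\<beta>\<in>Poly_Mapping.keys q.
      Poly_Mapping.single (\<alpha> + \<beta>) (Poly_Mapping.lookup p \<alpha> * Poly_Mapping.lookup q \<beta>))"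
    by (subst dec[of p], subst dec[of q]) (simp add: sum_product mult_single)
  then show ?thesis
    unfolding poly_eval_def[of p] poly_eval_def[of q] sum_product
    by (simp add: poly_eval_sum poly_eval_single lookup_add power_add prod.distrib algebra_simps)
qed

lemma poly_eval_Const [simp]: "poly_eval (Const c) x = c"
  by (simp add: Const_def poly_eval_single)

lemma poly_eval_1 [simp]: "poly_eval 1 x = 1"
  using poly_eval_Const[of 1 x] by (simp add: Const_def)

lemma poly_eval_Var [simp]: "poly_eval (Var i) x = x $ i"
proof -
  have "(x $ j) ^ Poly_Mapping.lookup (Poly_Mapping.single i 1) j = (if j = i then x $ i else 1)" for j
    by (simp add: lookup_single when_def)
  then show ?thesis
    unfolding Var_def poly_eval_single by (simp only: prod.delta) simp
qed

lemma poly_eval_power: "poly_eval (p ^ k) x = poly_eval p x ^ k"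
  by (induction k) (auto simp: poly_eval_mult)

lemma poly_eval_tensor_poly: "poly_eval (tensor_poly m A) x = tensor_form m A x"
proof -
  have "poly_eval (prod_list (map Var is)) x = prod_list (map (\<lambda>i. x $ i) is)" for "is"
    by (induction "is") (auto simp: poly_eval_mult)
  then show ?thesis
    by (simp add: tensor_poly_def tensor_form_def poly_eval_sum poly_eval_mult)
qed

lemma poly_eval_m_norm_poly:
  assumes "even m" "m > 0"
  shows "poly_eval (m_norm_poly m) x = m_norm m x ^ m"
proof -
  have "0 \<le> (\<Sum>i\<in>UNIV. \<bar>x $ i\<bar> ^ m)"
    by (intro sum_nonneg) simp
  then have "m_norm m x ^ m = (\<Sum>i\<in>UNIV. \<bar>x $ i\<bar> ^ m)"
    unfolding m_norm_def using assms(2) by (simp only: real_root_pow_pos2)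
  then show ?thesis
    using assms(1) by (simp add: m_norm_poly_def poly_eval_sum poly_eval_power power_even_abs)
qed

end

theory Submission
  imports Defs
begin

text \<open>
  The least \<open>H\<close>-eigenvalue \<open>\<lambda>\<close> is the minimum of \<open>f\<close> on the \<open>m\<close>-norm sphere, so \<open>f - \<lambda> * \<parallel>x\<parallel>\<^sup>m\<close> is
  nonnegative, and it suffices that nonnegative extended \<open>Z\<close>-polynomials are sums of squares.
  This may be checked on each block \<open>\<Gamma> l\<close> (set the other variables to zero). A block with
  nonpositive off-diagonal coefficients can be assumed, after subtracting a multiple of the power
  sum, to have a nonzero zero \<open>z \<ge> 0\<close>. If \<open>z > 0\<close>, the vanishing gradient writes the block as a
  nonnegative combination of AM-GM forms \<open>\<Sum>i. \<alpha> i * y i ^ m - m * y ^ \<alpha>\<close> with \<open>y i = x i / z i\<close>, which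
  are sums of squares by Hurwitz; otherwise the block decouples along the support of \<open>z\<close>, and
  induction on its size applies. A single positive off-diagonal term is a square or changes sign
  under a reflection.
\<close>

section \<open>Sums of squares and the inequality of Hurwitz\<close>

text \<open>Finite sums of squares in inductive form, so that closure properties follow by rule
  induction. No degree is tracked here; \<open>SOS_of_sos\<close> recovers the degree bound from
  homogeneity.\<close>

inductive_set sos :: "'a::comm_ring_1 set" where
  zero: "0 \<in> sos"
| step: "p \<in> sos \<Longrightarrow> q\<^sup>2 + p \<in> sos"

lemma sos_square: "q\<^sup>2 \<in> sos"
  using sos.step[OF sos.zero, of q] by simp

lemma sos_add: "p \<in> sos \<Longrightarrow> q \<in> sos \<Longrightarrow> p + q \<in> sos"
  by (induction rule: sos.induct) (auto simp: add.assoc intro: sos.step)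

lemma sos_sum: "(\<And>i. i \<in> I \<Longrightarrow> f i \<in> sos) \<Longrightarrow> sum f I \<in> sos"
  by (induction I rule: infinite_finite_induct) (auto intro: sos.zero sos_add)

lemma sos_square_mult: "p \<in> sos \<Longrightarrow> q\<^sup>2 * p \<in> sos"
  by (induction rule: sos.induct)
     (auto simp: distrib_left simp flip: power_mult_distrib intro: sos.zero sos.step)

lemma sos_mult: "p \<in> sos \<Longrightarrow> q \<in> sos \<Longrightarrow> p * q \<in> sos"
  by (induction rule: sos.induct)
     (auto simp: distrib_right intro: sos.zero sos_add sos_square_mult)

lemma sos_power: "p \<in> sos \<Longrightarrow> p ^ k \<in> sos"
proof (induction k)
  case 0
  then show ?case using sos_square[of 1] by simp
qed (auto intro: sos_mult)

lemma sos_imp_sum_of_squares: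
  "p \<in> sos \<Longrightarrow> \<exists>(k::nat) q. p = (\<Sum>j<k. (q j)\<^sup>2)"
proof (induction rule: sos.induct)
  case zero
  show ?case by (rule exI[of _ 0]) simp
next
  case (step p r)
  then obtain k :: nat and q where "p = (\<Sum>j<k. (q j)\<^sup>2)" by blast
  then have "r\<^sup>2 + p = (\<Sum>j<Suc k. (case_nat r q j)\<^sup>2)"
    by (subst sum.lessThan_Suc_shift) simp
  then show ?case by blast
qed

section \<open>Real constants as polynomials, and scaling of sums of squares\<close>

lemma Const_0 [simp]: "Const 0 = 0"
  and Const_1 [simp]: "Const 1 = 1"
  by (simp_all add: Const_def)

lemma Const_add: "Const (a + b) = Const a + Const b"
  by (simp add: Const_def single_add)

lemma Const_diff: "Const (a - b) = Const a - Const b"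
  by (simp add: Const_def single_diff)

lemma Const_uminus: "Const (- a) = - Const a"
  by (simp add: Const_def single_uminus)

lemma Const_mult: "Const (a * b) = Const a * Const b"
  by (simp add: Const_def mult_single)

lemma Const_power: "Const (a ^ k) = Const a ^ k"
  by (induction k) (auto simp: Const_mult)

lemma Const_sum: "Const (sum f I) = (\<Sum>i\<in>I. Const (f i))"
  by (induction I rule: infinite_finite_induct) (auto simp: Const_add)

lemma Const_prod: "Const (prod f I) = (\<Prod>i\<in>I. Const (f i))"
  by (induction I rule: infinite_finite_induct) (auto simp: Const_mult)

lemma Const_of_nat: "Const (real n) = of_nat n"
  by (induction n) (auto simp: Const_add)

lemma sos_scale: "0 \<le> c \<Longrightarrow> p \<in> sos \<Longrightarrow> Const c * p \<in> sos"
  using sos_square_mult[of p "Const (sqrt c)"] by (simp flip: Const_power)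

lemma sos_cancel_of_nat:
  fixes p :: "'n mpolynomial"
  assumes "of_nat n * p \<in> sos" "n > 0"
  shows "p \<in> sos"
proof -
  have "p = Const (1 / real n) * (of_nat n * p)"
    using assms(2) by (simp add: mult.assoc[symmetric] flip: Const_of_nat Const_mult)
  then show ?thesis
    using sos_scale[OF _ assms(1), of "1 / real n"] by simp
qed

text \<open>The factor \<open>s - t\<close> divides \<open>s ^ k - t ^ k\<close>, so the product is
  \<open>(s - t)\<^sup>2\<close> times a sum of products of powers of \<open>s\<close> and
  \<open>t\<close>.\<close>

lemma sos_power_diff:
  fixes s t :: "'a::comm_ring_1"
  assumes "s \<in> sos" "t \<in> sos"
  shows "(s - t) * (s ^ k - t ^ k) \<in> sos"
proof (cases k)
  case 0
  then show ?thesis by (simp add: sos.zero)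
next
  case (Suc n)
  have "(s - t) * (s ^ k - t ^ k) = (s - t)\<^sup>2 * (\<Sum>p<Suc n. s ^ p * t ^ (n - p))"
    unfolding Suc diff_power_eq_sum by (simp add: power2_eq_square algebra_simps del: sum.lessThan_Suc)
  also have "\<dots> \<in> sos"
    by (intro sos_square_mult sos_sum sos_mult sos_power assms)
  finally show ?thesis .
qed

text \<open>Induction on the number \<open>k + 1\<close> of factors. Take twice the sum over
  \<open>i\<close> of \<open>t i\<close> times the polynomial for \<open>I - {i}\<close>, and add
  the terms of \<open>sos_power_diff\<close> over all pairs. The mixed sums \<open>?D\<close>
  cancel, and \<open>2 * k\<close> times the wanted polynomial remains.\<close>

lemma sos_amgm:
  fixes t :: "'i \<Rightarrow> 'n mpolynomial"
  assumes "finite I" "\<And>i. i \<in> I \<Longrightarrow> t i \<in> sos"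
  shows "(\<Sum>i\<in>I. t i ^ card I) - of_nat (card I) * (\<Prod>i\<in>I. t i) \<in> sos"
  using assms
proof (induction "card I" arbitrary: I)
  case 0
  then show ?case by (simp add: sos.zero)
next
  case (Suc k)
  show ?case
  \<comment> \<open>One factor is treated separately, because the general argument divides by
    \<open>2 * k\<close>.\<close>
  proof (cases "k = 0")
    case True
    then obtain i where "I = {i}" using Suc.hyps(2) by (metis One_nat_def card_1_singletonE)
    then show ?thesis by (simp add: sos.zero)
  next
    case False
    have k: "card I = Suc k" using Suc by simp
    let ?P = "\<Prod>i\<in>I. t i" and ?S = "\<Sum>i\<in>I. t i ^ Suc k" and ?D = "\<Sum>i\<in>I. \<Sum>j\<in>I. t i * t j ^ k"
    let ?X = "\<lambda>i. t i * ((\<Sum>j\<in>I-{i}. t j ^ k) - of_nat k * (\<Prod>j\<in>I-{i}. t j))"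
    let ?Y = "\<lambda>i j. (t i - t j) * (t i ^ k - t j ^ k)"
    have X: "?X i = (\<Sum>j\<in>I. t i * t j ^ k) - t i ^ Suc k - of_nat k * ?P" if "i \<in> I" for i
      using that \<open>finite I\<close>
      by (simp add: sum_diff1 prod.remove[of I i] right_diff_distrib sum_distrib_left algebra_simps)
    have "sum ?X I = (\<Sum>i\<in>I. (\<Sum>j\<in>I. t i * t j ^ k) - t i ^ Suc k - of_nat k * ?P)"
      by (rule sum.cong[OF refl X])
    also have "\<dots> = ?D - ?S - of_nat k * of_nat (Suc k) * ?P"
      by (simp add: sum_subtractf sum.distrib k algebra_simps)
    finally have 1: "sum ?X I = ?D - ?S - of_nat k * of_nat (Suc k) * ?P" .
    have Y: "?Y i j = t i ^ Suc k + t j ^ Suc k - t i * t j ^ k - t j * t i ^ k" for i j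
      by (simp add: algebra_simps)
    have "(\<Sum>i\<in>I. \<Sum>j\<in>I. t j * t i ^ k) = ?D"
      by (rule sum.swap)
    then have 2: "(\<Sum>i\<in>I. \<Sum>j\<in>I. ?Y i j) = 2 * of_nat (Suc k) * ?S - 2 * ?D"
      unfolding Y by (simp add: sum.distrib sum_subtractf k sum_distrib_left[symmetric] algebra_simps)
    have "of_nat (2 * k) * (?S - of_nat (Suc k) * ?P)
        = sum ?X I + sum ?X I + (\<Sum>i\<in>I. \<Sum>j\<in>I. ?Y i j)"
      unfolding 1 2 by (simp add: algebra_simps)
    also have "\<dots> \<in> sos"
    proof -
      have "?X i \<in> sos" if "i \<in> I" for i
      proof (rule sos_mult)
        have "k = card (I - {i})" using k that by simp
        then show "(\<Sum>j\<in>I-{i}. t j ^ k) - of_nat k * (\<Prod>j\<in>I-{i}. t j) \<in> sos"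
          using Suc.hyps(1)[of "I - {i}"] Suc.prems by simp
      qed (use Suc.prems that in auto)
      moreover have "?Y i j \<in> sos" if "i \<in> I" "j \<in> I" for i j
        using that Suc.prems by (intro sos_power_diff) auto
      ultimately show ?thesis
        by (intro sos_add sos_sum) auto
    qed
    finally show ?thesis
      unfolding k by (rule sos_cancel_of_nat) (use False in simp)
  qed
qed

text \<open>The \<open>x i\<close> need not be sums of squares, so the index set is cut into two
  halves and \<open>sos_amgm\<close> is applied to the squares of the \<open>x i\<close> over each
  half. With \<open>a\<close> and \<open>b\<close> the products over the halves, what is left over
  is \<open>k\<close> times the square of \<open>a - b\<close>.\<close>

lemma sos_hurwitz:
  fixes x :: "'i \<Rightarrow> 'n mpolynomial"
  assumes "finite I" "even (card I)"
  shows "(\<Sum>i\<in>I. x i ^ card I) - of_nat (card I) * (\<Prod>i\<in>I. x i) \<in> sos"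
proof -
  obtain k where k: "card I = 2 * k" using assms(2) by (elim evenE)
  then obtain J where J: "J \<subseteq> I" "card J = k"
    using obtain_subset_with_card_n[of k I] by auto
  define K where "K = I - J"
  have fin: "finite J" "finite K" and K: "card K = k"
    using J k assms(1) by (auto simp: K_def card_Diff_subset finite_subset)
  have I: "I = J \<union> K" "J \<inter> K = {}" using J by (auto simp: K_def)
  define a b where "a = (\<Prod>i\<in>J. x i)" and "b = (\<Prod>i\<in>K. x i)"
  have half: "(\<Sum>i\<in>L. x i ^ (2 * k)) - of_nat k * (\<Prod>i\<in>L. x i)\<^sup>2 \<in> sos" if "finite L" "card L = k" for L
    using sos_amgm[of L "\<lambda>i. (x i)\<^sup>2"] that
    by (simp add: sos_square power_mult prod_power_distrib)
  have "(\<Sum>i\<in>I. x i ^ card I) - of_nat (card I) * (\<Prod>i\<in>I. x i) =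
      ((\<Sum>i\<in>J. x i ^ (2 * k)) - of_nat k * a\<^sup>2) + ((\<Sum>i\<in>K. x i ^ (2 * k)) - of_nat k * b\<^sup>2)
      + Const (real k) * (a - b)\<^sup>2"
    unfolding k unfolding I(1) sum.union_disjoint[OF fin I(2)] prod.union_disjoint[OF fin I(2)]
      a_def[symmetric] b_def[symmetric]
    by (simp add: Const_of_nat power2_eq_square algebra_simps)
  also have "\<dots> \<in> sos"
    using half[OF fin(1) J(2)] half[OF fin(2) K] unfolding a_def b_def
    by (intro sos_add sos_scale sos_square) auto
  finally show ?thesis .
qed

section \<open>Monomials evaluated in an arbitrary commutative semiring, and their AM-GM
  forms\<close>

definition monom_at :: "('n::finite \<Rightarrow>\<^sub>0 nat) \<Rightarrow> ('n \<Rightarrow> 'a::comm_semiring_1) \<Rightarrow> 'a" where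
  "monom_at \<alpha> y = (\<Prod>i\<in>UNIV. y i ^ Poly_Mapping.lookup \<alpha> i)"

text \<open>In \<open>?I\<close> each index \<open>i\<close> is repeated as often as
  \<open>\<alpha>\<close> prescribes, so that \<open>card ?I\<close> is the degree and
  \<open>sos_hurwitz\<close> applies to the repeated variables.\<close>

lemma sos_hurwitz_exponent:
  fixes y :: "'n::finite \<Rightarrow> 'v mpolynomial"
  assumes "even m" "mdegree \<alpha> = m"
  shows "(\<Sum>i\<in>UNIV. of_nat (Poly_Mapping.lookup \<alpha> i) * y i ^ m) - of_nat m * monom_at \<alpha> y \<in> sos"
proof -
  let ?I = "Sigma UNIV (\<lambda>i. {..<Poly_Mapping.lookup \<alpha> i})"
  have card: "card ?I = m" using assms(2) by (simp add: mdegree_def)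
  have "(\<Sum>p\<in>?I. y (fst p) ^ m) = (\<Sum>i\<in>UNIV. of_nat (Poly_Mapping.lookup \<alpha> i) * y i ^ m)"
    using sum.Sigma[of UNIV "\<lambda>i. {..<Poly_Mapping.lookup \<alpha> i}" "\<lambda>i j. y i ^ m"]
    by (simp add: case_prod_unfold)
  moreover have "(\<Prod>p\<in>?I. y (fst p)) = monom_at \<alpha> y"
    unfolding monom_at_def using prod.Sigma[of UNIV "\<lambda>i. {..<Poly_Mapping.lookup \<alpha> i}" "\<lambda>i j. y i"]
    by (simp add: case_prod_unfold)
  ultimately show ?thesis
    using sos_hurwitz[of ?I "\<lambda>p. y (fst p)"] card assms(1) by simp
qed

section \<open>Forms with prescribed diagonal and off-diagonal coefficients\<close>

text \<open>The map \<open>e\<close> is the identity for real values and \<open>Const\<close> for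
  polynomials, so that one set of lemmas serves both. Since \<open>c\<close> is defined on all
  exponents and restricted by \<open>Omega m V\<close> only, \<open>V\<close> can shrink while
  \<open>b\<close> and \<open>c\<close> stay the same.\<close>

definition form ::
  "(real \<Rightarrow> 'a::comm_ring_1) \<Rightarrow> nat \<Rightarrow> 'n::finite set \<Rightarrow> ('n \<Rightarrow> real) \<Rightarrow> (('n \<Rightarrow>\<^sub>0 nat) \<Rightarrow> real) \<Rightarrow> ('n \<Rightarrow> 'a) \<Rightarrow> 'a"
  where "form e m V b c y =
    (\<Sum>i\<in>V. e (b i) * y i ^ m) + (\<Sum>\<alpha>\<in>Omega m V. e (c \<alpha>) * monom_at \<alpha> y)"

abbreviation real_form where "real_form \<equiv> form (\<lambda>r::real. r)"

lemma OmegaD: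
  assumes "\<alpha> \<in> Omega m V"
  shows "mdegree \<alpha> = m" "Poly_Mapping.keys \<alpha> \<subseteq> V" "\<alpha> \<noteq> Poly_Mapping.single i m"
  using assms by (auto simp: Omega_def)

lemma lookup_Omega_outside: "\<alpha> \<in> Omega m V \<Longrightarrow> i \<notin> V \<Longrightarrow> Poly_Mapping.lookup \<alpha> i = 0"
  by (auto simp: Omega_def in_keys_iff)

lemma monom_at_cong:
  assumes "\<And>i. i \<in> Poly_Mapping.keys \<alpha> \<Longrightarrow> x i = y i"
  shows "monom_at \<alpha> x = monom_at \<alpha> y"
proof -
  have "x i ^ Poly_Mapping.lookup \<alpha> i = y i ^ Poly_Mapping.lookup \<alpha> i" for i
    using assms[of i] by (cases "i \<in> Poly_Mapping.keys \<alpha>") (simp_all add: in_keys_iff)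
  then show ?thesis by (simp add: monom_at_def)
qed

lemma monom_at_mult: "monom_at \<alpha> (\<lambda>i. x i * y i) = monom_at \<alpha> x * monom_at \<alpha> y"
  by (simp add: monom_at_def power_mult_distrib prod.distrib)

lemma monom_at_eq_0:
  assumes "i \<in> Poly_Mapping.keys \<alpha>" "x i = 0"
  shows "monom_at \<alpha> x = 0"
proof -
  have "x i ^ Poly_Mapping.lookup \<alpha> i = 0"
    using assms by (simp add: in_keys_iff power_0_left)
  then show ?thesis
    unfolding monom_at_def by (subst prod.remove[of _ i]) auto
qed

lemma monom_at_pos:
  fixes x :: "'n::finite \<Rightarrow> real"
  assumes "\<And>i. i \<in> Poly_Mapping.keys \<alpha> \<Longrightarrow> x i > 0"
  shows "monom_at \<alpha> x > 0"
proof -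
  have "monom_at \<alpha> x = monom_at \<alpha> (\<lambda>i. if i \<in> Poly_Mapping.keys \<alpha> then x i else 1)"
    by (rule monom_at_cong) simp
  also have "\<dots> > 0"
    unfolding monom_at_def using assms by (intro prod_pos) simp
  finally show ?thesis .
qed

lemma monom_at_mono:
  fixes x :: "'n::finite \<Rightarrow> real"
  assumes "\<And>i. 0 \<le> x i" "\<And>i. x i \<le> y i"
  shows "monom_at \<alpha> x \<le> monom_at \<alpha> y"
  unfolding monom_at_def using assms by (intro prod_mono) (auto intro: power_mono)

lemma monom_at_indicator:
  "monom_at \<alpha> (\<lambda>i. if i \<in> W then t else 1) = t ^ (\<Sum>i\<in>W. Poly_Mapping.lookup \<alpha> i)"
proof -
  have "monom_at \<alpha> (\<lambda>i. if i \<in> W then t else 1)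
      = (\<Prod>i\<in>UNIV. if i \<in> W then t ^ Poly_Mapping.lookup \<alpha> i else 1)"
    unfolding monom_at_def by (intro prod.cong) auto
  then show ?thesis
    by (simp add: prod.inter_restrict[symmetric] power_sum)
qed

lemma monom_at_upd:
  "monom_at \<alpha> (z(i := t * z i)) = t ^ Poly_Mapping.lookup \<alpha> i * monom_at \<alpha> z"
proof -
  have "z(i := t * z i) = (\<lambda>j. (if j \<in> {i} then t else 1) * z j)" by auto
  then show ?thesis by (simp only: monom_at_mult monom_at_indicator) simp
qed

lemma monom_at_scale: "monom_at \<alpha> (\<lambda>i. t * x i) = t ^ mdegree \<alpha> * monom_at \<alpha> x"
  using monom_at_indicator[of \<alpha> UNIV t] by (simp add: monom_at_mult mdegree_def)

lemma monom_at_inverse: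
  fixes z :: "'n::finite \<Rightarrow> real"
  shows "monom_at \<alpha> (\<lambda>i. inverse (z i)) = inverse (monom_at \<alpha> z)"
  by (simp add: monom_at_def power_inverse prod_inversef[symmetric] o_def)

lemma monom_at_Const: "monom_at \<alpha> (\<lambda>i. Const (x i)) = Const (monom_at \<alpha> x)"
  by (simp add: monom_at_def Const_prod Const_power)

lemma form_cong:
  assumes "\<And>i. i \<in> V \<Longrightarrow> x i = y i"
  shows "form e m V b c x = form e m V b c y"
proof -
  have "monom_at \<alpha> x = monom_at \<alpha> y" if "\<alpha> \<in> Omega m V" for \<alpha>
    using OmegaD(2)[OF that] assms by (intro monom_at_cong) auto
  then show ?thesis using assms by (simp add: form_def)
qed

lemma form_zero:
  assumes "m > 0" "\<And>i. i \<in> V \<Longrightarrow> x i = 0"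
  shows "form e m V b c x = 0"
proof -
  have "monom_at \<alpha> x = 0" if \<alpha>: "\<alpha> \<in> Omega m V" for \<alpha>
  proof -
    have "Poly_Mapping.keys \<alpha> \<noteq> {}"
      using OmegaD(1)[OF \<alpha>] assms(1) by (auto simp: mdegree_def)
    then show ?thesis
      using OmegaD(2)[OF \<alpha>] assms(2) monom_at_eq_0 by blast
  qed
  then show ?thesis using assms by (simp add: form_def zero_power)
qed

text \<open>Monomials mixing \<open>S\<close> and \<open>V - S\<close> have coefficient zero by
  assumption. Positivity of \<open>m\<close> excludes the constant monomial, the only one supported
  in both parts.\<close>

lemma form_split:
  assumes "e 0 = 0" "m > 0" "S \<subseteq> V"
    and "\<And>\<alpha>. \<alpha> \<in> Omega m V \<Longrightarrow> \<not> Poly_Mapping.keys \<alpha> \<subseteq> S \<Longrightarrow> \<not> Poly_Mapping.keys \<alpha> \<subseteq> V - S \<Longrightarrow> c \<alpha> = 0"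
  shows "form e m V b c y = form e m S b c y + form e m (V - S) b c y"
proof -
  have "(\<Sum>\<alpha>\<in>Omega m V. e (c \<alpha>) * monom_at \<alpha> y)
      = (\<Sum>\<alpha>\<in>Omega m S \<union> Omega m (V - S). e (c \<alpha>) * monom_at \<alpha> y)"
  proof (rule sum.mono_neutral_right[OF finite_Omega])
    show "Omega m S \<union> Omega m (V - S) \<subseteq> Omega m V"
      using assms(3) by (auto simp: Omega_def)
    show "\<forall>\<alpha>\<in>Omega m V - (Omega m S \<union> Omega m (V - S)). e (c \<alpha>) * monom_at \<alpha> y = 0"
    proof
      fix \<alpha> assume \<alpha>: "\<alpha> \<in> Omega m V - (Omega m S \<union> Omega m (V - S))"
      then have "\<not> Poly_Mapping.keys \<alpha> \<subseteq> S" "\<not> Poly_Mapping.keys \<alpha> \<subseteq> V - S"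
        unfolding Omega_def by blast+
      then show "e (c \<alpha>) * monom_at \<alpha> y = 0"
        using assms(1,4) \<alpha> by simp
    qed
  qed
  also have "\<dots> = (\<Sum>\<alpha>\<in>Omega m S. e (c \<alpha>) * monom_at \<alpha> y) + (\<Sum>\<alpha>\<in>Omega m (V - S). e (c \<alpha>) * monom_at \<alpha> y)"
  proof (rule sum.union_disjoint[OF finite_Omega finite_Omega])
    show "Omega m S \<inter> Omega m (V - S) = {}"
    proof safe
      fix \<alpha> assume a: "\<alpha> \<in> Omega m S" "\<alpha> \<in> Omega m (V - S)"
      have "Poly_Mapping.keys \<alpha> = {}" using OmegaD(2)[OF a(1)] OmegaD(2)[OF a(2)] by blast
      then show "\<alpha> \<in> {}"
        using OmegaD(1)[OF a(1)] assms(2) by (simp add: mdegree_def)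
    qed
  qed
  finally show ?thesis
    using sum.subset_diff[OF assms(3), of "\<lambda>i. e (b i) * y i ^ m"] by (simp add: form_def)
qed

lemma form_shift_diag:
  assumes "\<And>r s. e (r - s) = e r - e s"
  shows "form e m V (\<lambda>i. b i - l) c y = form e m V b c y - e l * (\<Sum>i\<in>V. y i ^ m)"
  by (simp add: form_def assms sum_subtractf sum_distrib_left algebra_simps)

text \<open>The quotient of \<open>h\<close> by the power sum is homogeneous of degree 0. Its
  minimum over the compact unit sphere of the coordinate subspace of \<open>V\<close> is therefore
  its minimum over all nonzero points there. This serves both the blocks and the least
  \<open>H\<close>-eigenvalue.\<close>

lemma homogeneous_minimum:
  fixes h :: "real ^ 'n::finite \<Rightarrow> real"
  assumes m: "even m" "m > 0" and V: "V \<noteq> {}"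
    and cont: "continuous_on UNIV h" and hom: "\<And>t x. h (t *\<^sub>R x) = t ^ m * h x"
  obtains l z where "z \<noteq> 0" "\<And>i. i \<notin> V \<Longrightarrow> z $ i = 0" "h z = l * (\<Sum>i\<in>V. (z $ i) ^ m)"
    "\<And>x. (\<And>i. i \<notin> V \<Longrightarrow> x $ i = 0) \<Longrightarrow> l * (\<Sum>i\<in>V. (x $ i) ^ m) \<le> h x"
proof -
  define N :: "real ^ 'n \<Rightarrow> real" where "N x = (\<Sum>i\<in>V. (x $ i) ^ m)" for x
  define E :: "(real ^ 'n) set" where "E = {x. \<forall>i\<in>-V. x $ i = 0}"
  have N_pos: "N x > 0" if "x \<in> E" "x \<noteq> 0" for x
  proof -
    obtain i where i: "x $ i \<noteq> 0" using \<open>x \<noteq> 0\<close> by (auto simp: vec_eq_iff)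
    then have "i \<in> V" using \<open>x \<in> E\<close> by (auto simp: E_def)
    then show ?thesis
      unfolding N_def using i m(1) by (intro sum_pos2[of _ i]) (auto simp: zero_less_power_eq zero_le_even_power)
  qed
  have N_hom: "N (t *\<^sub>R x) = t ^ m * N x" for t x
    by (simp add: N_def power_mult_distrib sum_distrib_left)
  obtain v where "v \<in> V" using V by blast
  then have "axis v 1 \<in> E" by (auto simp: E_def axis_def)
  then have "axis v 1 \<in> sphere 0 1 \<inter> E" by (simp add: norm_axis_1)
  then have "sphere 0 1 \<inter> E \<noteq> {}" by blast
  moreover have "compact (sphere 0 1 \<inter> E)"
  proof (rule compact_Int_closed[OF compact_sphere])
    show "closed E"
      unfolding E_def Ball_def
      by (intro closed_Collect_all closed_Collect_imp open_Collect_const closed_Collect_eq continuous_intros)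
  qed
  moreover have "continuous_on (sphere 0 1 \<inter> E) (\<lambda>x. h x / N x)"
  proof (intro continuous_on_divide ballI)
    show "continuous_on (sphere 0 1 \<inter> E) N"
      unfolding N_def by (intro continuous_intros)
    show "N x \<noteq> 0" if "x \<in> sphere 0 1 \<inter> E" for x
      using N_pos[of x] that by force
  qed (rule continuous_on_subset[OF cont], simp)
  ultimately obtain z where z: "z \<in> sphere 0 1 \<inter> E"
      "\<And>x. x \<in> sphere 0 1 \<inter> E \<Longrightarrow> h z / N z \<le> h x / N x"
    using continuous_attains_inf[of "sphere 0 1 \<inter> E" "\<lambda>x. h x / N x"] by blast
  have "z \<noteq> 0" using z(1) by auto
  show ?thesis
  proof (rule that[of z "h z / N z"])
    show "h z = h z / N z * (\<Sum>i\<in>V. (z $ i) ^ m)"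
      using N_pos[of z] z(1) \<open>z \<noteq> 0\<close> by (simp add: N_def)
    fix x :: "real ^ 'n" assume "\<And>i. i \<notin> V \<Longrightarrow> x $ i = 0"
    then have x: "x \<in> E" by (simp add: E_def)
    show "h z / N z * (\<Sum>i\<in>V. (x $ i) ^ m) \<le> h x"
    proof (cases "x = 0")
      case True
      \<comment> \<open>Homogeneity with \<open>t = 0\<close> gives \<open>h 0 = 0\<close>.\<close>
      then show ?thesis using hom[of 0 0] m(2) by (simp add: zero_power)
    next
      case False
      define s where "s = inverse (norm x)"
      have "s > 0" using False by (simp add: s_def)
      have "s *\<^sub>R x \<in> sphere 0 1 \<inter> E"
        using False x by (auto simp: s_def E_def)
      from z(2)[OF this] have "h z / N z \<le> h x / N x"
        using \<open>s > 0\<close> by (simp add: hom N_hom)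
      then show ?thesis
        using N_pos[OF x False] by (simp add: pos_le_divide_eq N_def)
    qed
  qed (use z(1) \<open>z \<noteq> 0\<close> in \<open>auto simp: E_def\<close>)
qed

text \<open>A zero of a nonnegative form is a minimum, so multiplying its coordinate
  \<open>i\<close> by \<open>t\<close> gives a function of \<open>t\<close> that is minimal at
  \<open>t = 1\<close>. The vanishing derivative is \<open>z i\<close> times the partial derivative;
  this multiplicative version keeps the monomials of the form intact.\<close>

lemma real_form_critical:
  assumes i: "i \<in> V" and psd: "\<And>x. 0 \<le> real_form m V b c x" and z: "real_form m V b c z = 0"
  shows "real m * b i * z i ^ m + (\<Sum>\<alpha>\<in>Omega m V. real (Poly_Mapping.lookup \<alpha> i) * c \<alpha> * monom_at \<alpha> z) = 0"
proof -
  define g where "g t = real_form m V b c (z(i := t * z i))" for t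
  have "(\<Sum>j\<in>V. b j * (z(i := t * z i)) j ^ m) = (\<Sum>j\<in>V - {i}. b j * z j ^ m) + b i * z i ^ m * t ^ m" for t
    using i by (subst sum.remove[of _ i]) (auto simp: power_mult_distrib)
  then have "g = (\<lambda>t. (\<Sum>j\<in>V - {i}. b j * z j ^ m) + b i * z i ^ m * t ^ m
      + (\<Sum>\<alpha>\<in>Omega m V. c \<alpha> * (t ^ Poly_Mapping.lookup \<alpha> i * monom_at \<alpha> z)))"
    unfolding g_def form_def monom_at_upd by auto
  then have "DERIV g 1 :> real m * b i * z i ^ m
      + (\<Sum>\<alpha>\<in>Omega m V. real (Poly_Mapping.lookup \<alpha> i) * c \<alpha> * monom_at \<alpha> z)"
    by (auto intro!: derivative_eq_intros sum.cong simp: algebra_simps)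
  moreover have "g 1 \<le> g t" for t
    using psd z by (simp add: g_def)
  ultimately show ?thesis
    using DERIV_local_min[of g _ 1 1] by auto
qed

text \<open>
  If a mixed monomial of degree \<open>k < m\<close> in the variables where \<open>z\<close> vanishes had a negative
  coefficient, raising these variables to \<open>t\<close> would change the form by at most
  \<open>O(t ^ m) - const * t ^ k\<close>, which is negative for small \<open>t\<close>.
\<close>

lemma real_form_mixed_zero:
  assumes c: "\<And>\<alpha>. \<alpha> \<in> Omega m V \<Longrightarrow> c \<alpha> \<le> 0"
    and psd: "\<And>x. 0 \<le> real_form m V b c x" and z: "real_form m V b c z = 0"
    and m: "m > 0" and nonneg: "\<And>i. 0 \<le> z i"
    and \<beta>: "\<beta> \<in> Omega m V" "\<not> Poly_Mapping.keys \<beta> \<subseteq> {i\<in>V. z i \<noteq> 0}"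
      "\<not> Poly_Mapping.keys \<beta> \<subseteq> {i\<in>V. z i = 0}"
  shows "c \<beta> = 0"
proof (rule ccontr)
  assume "c \<beta> \<noteq> 0"
  then have c_neg: "c \<beta> < 0" using c[OF \<beta>(1)] by simp
  define W where "W = {i\<in>V. z i = 0}"
  \<comment> \<open>The point \<open>x t\<close> puts \<open>t\<close> in place of the zeros of
    \<open>z\<close>. There the term of \<open>\<beta>\<close> equals \<open>- p * t ^ k\<close>,
    where \<open>k\<close> is the degree of \<open>\<beta>\<close> in the vanishing
    variables.\<close>
  define w where "w i = (if i \<in> W then 1 else z i)" for i
  define x where "x t i = (if i \<in> W then t else z i)" for t i
  define k where "k = (\<Sum>i\<in>W. Poly_Mapping.lookup \<beta> i)"
  define p where "p = - c \<beta> * monom_at \<beta> w"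
  define K where "K = (\<Sum>i\<in>W. b i)"
  have keys: "Poly_Mapping.keys \<beta> \<subseteq> V" using OmegaD(2)[OF \<beta>(1)] .
  have "p > 0"
  proof -
    have "w i > 0" if "i \<in> Poly_Mapping.keys \<beta>" for i
      using that keys nonneg[of i] by (auto simp: w_def W_def)
    then show ?thesis unfolding p_def using c_neg monom_at_pos[of \<beta> w] by (simp add: mult_neg_pos)
  qed
  \<comment> \<open>The index \<open>j\<close> makes \<open>k\<close> smaller than \<open>m\<close>,
    and \<open>j'\<close> makes the term of \<open>\<beta>\<close> vanish at
    \<open>z\<close>.\<close>
  obtain j where j: "j \<in> Poly_Mapping.keys \<beta>" "z j \<noteq> 0" using \<beta>(3) keys by blast
  obtain j' where j': "j' \<in> Poly_Mapping.keys \<beta>" "z j' = 0" using \<beta>(2) keys by blast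
  have "k < mdegree \<beta>"
    unfolding k_def mdegree_def using j
    by (intro sum_strict_mono2[of UNIV W j]) (auto simp: W_def in_keys_iff)
  then have "k \<le> m - 1" using OmegaD(1)[OF \<beta>(1)] by simp
  \<comment> \<open>This is nonnegativity at \<open>x t\<close> divided by
    \<open>t ^ (m - 1)\<close>, where \<open>t ^ k\<close> is first bounded below by
    \<open>t ^ (m - 1)\<close>.\<close>
  have bound: "p \<le> t * K" if t: "0 < t" "t \<le> 1" for t
  proof -
    have x: "x t = (\<lambda>i. (if i \<in> W then t else 1) * w i)" by (auto simp: x_def w_def)
    have x_ge: "z i \<le> x t i" for i using t by (auto simp: x_def W_def)
    have "(\<Sum>i\<in>V. b i * x t i ^ m) = (\<Sum>i\<in>V. b i * z i ^ m) + (\<Sum>i\<in>V. if i \<in> W then b i * t ^ m else 0)"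
      unfolding sum.distrib[symmetric] using m by (intro sum.cong) (auto simp: x_def W_def)
    also have "(\<Sum>i\<in>V. if i \<in> W then b i * t ^ m else 0) = t ^ m * K"
    proof -
      have "V \<inter> W = W" by (auto simp: W_def)
      then show ?thesis
        unfolding K_def by (simp add: sum.inter_restrict[symmetric] sum_distrib_right[symmetric] mult.commute)
    qed
    finally have diag: "(\<Sum>i\<in>V. b i * x t i ^ m) = (\<Sum>i\<in>V. b i * z i ^ m) + t ^ m * K" .
    \<comment> \<open>Passing from \<open>z\<close> to \<open>x t\<close> lowers no coordinate, so
      no off-diagonal term grows. Only the drop in the term of \<open>\<beta>\<close> is
      quantified.\<close>
    have le: "c \<alpha> * monom_at \<alpha> (x t) \<le> c \<alpha> * monom_at \<alpha> z" if "\<alpha> \<in> Omega m V" for \<alpha>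
      using c[OF that] monom_at_mono[of z "x t" \<alpha>] nonneg x_ge by (simp add: mult_left_mono_neg)
    have \<beta>_z: "c \<beta> * monom_at \<beta> z = 0"
      using monom_at_eq_0[of j' \<beta> z] j' by simp
    have \<beta>_x: "c \<beta> * monom_at \<beta> (x t) = - p * t ^ k"
      unfolding x monom_at_mult monom_at_indicator p_def k_def by simp
    have "(\<Sum>\<alpha>\<in>Omega m V. c \<alpha> * monom_at \<alpha> (x t)) \<le> (\<Sum>\<alpha>\<in>Omega m V. c \<alpha> * monom_at \<alpha> z) - p * t ^ k"
    proof -
      have "(\<Sum>\<alpha>\<in>Omega m V - {\<beta>}. c \<alpha> * monom_at \<alpha> (x t)) \<le> (\<Sum>\<alpha>\<in>Omega m V - {\<beta>}. c \<alpha> * monom_at \<alpha> z)"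
        by (rule sum_mono) (use le in auto)
      then show ?thesis
        unfolding sum.remove[OF finite_Omega \<beta>(1)] using \<beta>_z \<beta>_x by linarith
    qed
    then have "0 \<le> t ^ m * K - p * t ^ k"
      using psd[of "x t"] z diag by (simp add: form_def)
    moreover have "p * t ^ (m - 1) \<le> p * t ^ k"
      using \<open>p > 0\<close> t \<open>k \<le> m - 1\<close> by (simp add: power_decreasing)
    ultimately have "t ^ (m - 1) * p \<le> t ^ (m - 1) * (t * K)"
      using m by (cases m) (auto simp: algebra_simps)
    then show ?thesis using t by simp
  qed
  \<comment> \<open>This choice makes \<open>t * K\<close> at most \<open>p / 2\<close>, against
    \<open>bound\<close>; adding 1 keeps the denominator positive when \<open>K = 0\<close>.\<close>
  define t where "t = min 1 (p / (2 * (\<bar>K\<bar> + 1)))"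
  have t: "0 < t" "t \<le> 1" using \<open>p > 0\<close> by (auto simp: t_def)
  have "t * K \<le> t * (\<bar>K\<bar> + 1)" using t by (intro mult_left_mono) auto
  also have "\<dots> \<le> p / (2 * (\<bar>K\<bar> + 1)) * (\<bar>K\<bar> + 1)" by (intro mult_right_mono) (auto simp: t_def)
  also have "\<dots> = p / 2" by (simp add: field_simps)
  finally show False using bound[OF t] \<open>p > 0\<close> by simp
qed

section \<open>Nonnegative blocks are sums of squares\<close>

lemma sum_even_power_pos:
  fixes z :: "'n \<Rightarrow> real"
  assumes "even m" "finite V" "i \<in> V" "z i \<noteq> 0"
  shows "(\<Sum>i\<in>V. z i ^ m) > 0"
  using assms by (intro sum_pos2[of V i]) (auto simp: zero_less_power_eq zero_le_even_power)

lemma sos_even_power: "even m \<Longrightarrow> p ^ m \<in> sos"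
  by (metis evenE power_even_eq mult.commute sos_square)

lemma continuous_real_form: "continuous_on UNIV (\<lambda>x::real^'n::finite. real_form m V b c (($) x))"
  unfolding form_def monom_at_def by (intro continuous_intros)

lemma real_form_scale: "real_form m V b c (\<lambda>i. t * x i) = t ^ m * real_form m V b c x"
proof -
  have "monom_at \<alpha> (\<lambda>i. t * x i) = t ^ m * monom_at \<alpha> x" if "\<alpha> \<in> Omega m V" for \<alpha>
    using OmegaD(1)[OF that] by (simp add: monom_at_scale)
  then show ?thesis
    by (simp add: form_def power_mult_distrib distrib_left sum_distrib_left algebra_simps)
qed

text \<open>Taking absolute values leaves the even powers alone and can only increase the monomials,
  whose coefficients are nonpositive. A minimizer may thus be taken with nonnegative
  coordinates.\<close>

lemma real_form_abs_le:
  assumes "even m" "\<And>\<alpha>. \<alpha> \<in> Omega m V \<Longrightarrow> c \<alpha> \<le> 0"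
  shows "real_form m V b c (\<lambda>i. \<bar>z i\<bar>) \<le> real_form m V b c z"
proof -
  have "monom_at \<alpha> (\<lambda>i. \<bar>z i\<bar>) = \<bar>monom_at \<alpha> z\<bar>" for \<alpha>
    by (simp add: monom_at_def abs_prod power_abs)
  then have "c \<alpha> * monom_at \<alpha> (\<lambda>i. \<bar>z i\<bar>) \<le> c \<alpha> * monom_at \<alpha> z" if "\<alpha> \<in> Omega m V" for \<alpha>
    using assms(2)[OF that] by (simp add: mult_left_mono_neg)
  then show ?thesis
    using assms(1) by (auto simp: form_def power_even_abs intro: sum_mono)
qed

text \<open>In the coordinates \<open>w\<close> the zero becomes the all-ones point, where every
  AM-GM form \<open>H \<alpha>\<close> vanishes. The weights \<open>q \<alpha>\<close> are dictated
  by the off-diagonal coefficients and are nonnegative.\<close>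

lemma sos_form_interior_zero:
  fixes y :: "'n::finite \<Rightarrow> 'v mpolynomial"
  assumes m: "even m" "m > 0"
    and c: "\<And>\<alpha>. \<alpha> \<in> Omega m V \<Longrightarrow> c \<alpha> \<le> 0"
    and psd: "\<And>x. 0 \<le> real_form m V b c x" and z: "real_form m V b c z = 0"
    and pos: "\<And>i. i \<in> V \<Longrightarrow> z i > 0"
  shows "form Const m V b c y \<in> sos"
proof -
  define w where "w i = Const (inverse (z i)) * y i" for i
  define q where "q \<alpha> = - c \<alpha> * monom_at \<alpha> z / real m" for \<alpha>
  define H where "H \<alpha> = (\<Sum>i\<in>UNIV. of_nat (Poly_Mapping.lookup \<alpha> i) * w i ^ m) - of_nat m * monom_at \<alpha> w" for \<alpha>
  have monom_pos: "monom_at \<alpha> z > 0" if "\<alpha> \<in> Omega m V" for \<alpha>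
    using OmegaD(2)[OF that] pos by (intro monom_at_pos) auto
  have "Const (q \<alpha>) * H \<alpha> =
      (\<Sum>i\<in>V. Const (q \<alpha> * real (Poly_Mapping.lookup \<alpha> i) * inverse (z i) ^ m) * y i ^ m)
      + Const (c \<alpha>) * monom_at \<alpha> y" if \<alpha>: "\<alpha> \<in> Omega m V" for \<alpha>
  proof -
    have "(\<Sum>i\<in>UNIV. of_nat (Poly_Mapping.lookup \<alpha> i) * w i ^ m)
        = (\<Sum>i\<in>V. of_nat (Poly_Mapping.lookup \<alpha> i) * w i ^ m)"
      by (rule sum.mono_neutral_right) (auto simp: lookup_Omega_outside[OF \<alpha>])
    then have "Const (q \<alpha>) * (\<Sum>i\<in>UNIV. of_nat (Poly_Mapping.lookup \<alpha> i) * w i ^ m)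
        = (\<Sum>i\<in>V. Const (q \<alpha> * real (Poly_Mapping.lookup \<alpha> i) * inverse (z i) ^ m) * y i ^ m)"
      by (simp add: sum_distrib_left w_def power_mult_distrib Const_mult Const_power Const_of_nat mult.assoc)
    moreover have "Const (q \<alpha>) * (of_nat m * monom_at \<alpha> w)
        = Const (q \<alpha> * real m * inverse (monom_at \<alpha> z)) * monom_at \<alpha> y"
      unfolding w_def monom_at_mult monom_at_Const monom_at_inverse
      by (simp add: Const_mult Const_of_nat mult.assoc)
    moreover have "q \<alpha> * real m * inverse (monom_at \<alpha> z) = - c \<alpha>"
      using monom_pos[OF \<alpha>] m(2) by (simp add: q_def)
    ultimately show ?thesis
      by (simp add: H_def right_diff_distrib Const_uminus)
  qed
  then have "(\<Sum>\<alpha>\<in>Omega m V. Const (q \<alpha>) * H \<alpha>)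
      = (\<Sum>\<alpha>\<in>Omega m V. \<Sum>i\<in>V. Const (q \<alpha> * real (Poly_Mapping.lookup \<alpha> i) * inverse (z i) ^ m) * y i ^ m)
        + (\<Sum>\<alpha>\<in>Omega m V. Const (c \<alpha>) * monom_at \<alpha> y)"
    by (simp add: sum.distrib)
  also have "(\<Sum>\<alpha>\<in>Omega m V. \<Sum>i\<in>V. Const (q \<alpha> * real (Poly_Mapping.lookup \<alpha> i) * inverse (z i) ^ m) * y i ^ m)
      = (\<Sum>i\<in>V. Const (\<Sum>\<alpha>\<in>Omega m V. q \<alpha> * real (Poly_Mapping.lookup \<alpha> i) * inverse (z i) ^ m) * y i ^ m)"
    by (subst sum.swap) (simp add: Const_sum sum_distrib_right)
  also have "\<dots> = (\<Sum>i\<in>V. Const (b i) * y i ^ m)"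
  proof (rule sum.cong[OF refl])
    fix i assume i: "i \<in> V"
    let ?T = "\<Sum>\<alpha>\<in>Omega m V. real (Poly_Mapping.lookup \<alpha> i) * c \<alpha> * monom_at \<alpha> z"
    have "(\<Sum>\<alpha>\<in>Omega m V. q \<alpha> * real (Poly_Mapping.lookup \<alpha> i) * inverse (z i) ^ m)
        = - ?T / (real m * z i ^ m)"
      unfolding sum_negf[symmetric] sum_divide_distrib
      by (intro sum.cong) (simp_all add: q_def field_simps)
    \<comment> \<open>With the weights fixed, the diagonal coefficients agree exactly because of the
      critical point equation.\<close>
    also have "- ?T = b i * (real m * z i ^ m)"
      using real_form_critical[OF i psd z] by (simp add: algebra_simps)
    also have "\<dots> / (real m * z i ^ m) = b i"
      using pos[OF i] m(2) by simp
    finally show "Const (\<Sum>\<alpha>\<in>Omega m V. q \<alpha> * real (Poly_Mapping.lookup \<alpha> i) * inverse (z i) ^ m) * y i ^ m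
        = Const (b i) * y i ^ m" by simp
  qed
  finally have "form Const m V b c y = (\<Sum>\<alpha>\<in>Omega m V. Const (q \<alpha>) * H \<alpha>)"
    by (simp add: form_def)
  also have "\<dots> \<in> sos"
  proof (intro sos_sum sos_scale)
    fix \<alpha> assume \<alpha>: "\<alpha> \<in> Omega m V"
    show "0 \<le> q \<alpha>"
      using c[OF \<alpha>] monom_pos[OF \<alpha>] by (simp add: q_def divide_nonpos_nonneg mult_nonpos_nonneg)
    show "H \<alpha> \<in> sos"
      unfolding H_def by (rule sos_hurwitz_exponent[OF m(1) OmegaD(1)[OF \<alpha>]])
  qed
  finally show ?thesis .
qed

text \<open>Setting the variables of one part to zero kills its summand and leaves the other
  unchanged.\<close>

lemma real_form_psd_restrict:
  assumes psd: "\<And>x. 0 \<le> real_form m V b c x" and m: "m > 0" and S: "S \<subseteq> V"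
    and split: "\<And>x. real_form m V b c x = real_form m S b c x + real_form m (V - S) b c x"
  shows "0 \<le> real_form m S b c x" "0 \<le> real_form m (V - S) b c x"
proof -
  let ?u = "\<lambda>i. if i \<in> S then x i else 0" and ?v = "\<lambda>i. if i \<in> S then 0 else x i"
  have "real_form m S b c ?u = real_form m S b c x" "real_form m (V - S) b c ?v = real_form m (V - S) b c x"
    by (auto intro!: form_cong)
  moreover have "real_form m (V - S) b c ?u = 0" "real_form m S b c ?v = 0"
    by (auto intro!: form_zero m)
  ultimately show "0 \<le> real_form m S b c x" "0 \<le> real_form m (V - S) b c x"
    using psd[of ?u] psd[of ?v] unfolding split by simp_all
qed

text \<open>Strong induction on the size of \<open>V\<close>, after lowering the diagonal by the
  minimal quotient \<open>l\<close> to create a zero. The arguments \<open>y\<close> are arbitrary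
  polynomials, so that a reflected variable can be substituted in
  \<open>psd_extended_Z_block_sos\<close>.\<close>

theorem psd_diagonal_minus_tail_sos:
  fixes y :: "'n::finite \<Rightarrow> 'v mpolynomial"
  assumes m: "even m" "m > 0"
    and "\<And>\<alpha>. \<alpha> \<in> Omega m V \<Longrightarrow> c \<alpha> \<le> 0"
    and "\<And>x. 0 \<le> real_form m V b c x"
  shows "form Const m V b c y \<in> sos"
  using assms(3,4)
proof (induction "card V" arbitrary: V b rule: less_induct)
  case less
  note c = less.prems(1) and psd = less.prems(2)
  show ?case
  proof (cases "V = {}")
    case True
    then show ?thesis using m(2) form_zero[of m V y Const b c] by (simp add: sos.zero)
  next
    case False
    obtain l and z0 :: "real ^ 'n" where z0: "z0 \<noteq> 0" "\<And>i. i \<notin> V \<Longrightarrow> z0 $ i = 0"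
        "real_form m V b c (($) z0) = l * (\<Sum>i\<in>V. (z0 $ i) ^ m)"
      and l: "\<And>x::real^'n. (\<And>i. i \<notin> V \<Longrightarrow> x $ i = 0) \<Longrightarrow>
        l * (\<Sum>i\<in>V. (x $ i) ^ m) \<le> real_form m V b c (($) x)"
    proof (rule homogeneous_minimum[OF m False continuous_real_form])
      show "real_form m V b c (($) (t *\<^sub>R x)) = t ^ m * real_form m V b c (($) x)" for t and x :: "real ^ 'n"
      proof -
        have "($) (t *\<^sub>R x) = (\<lambda>i. t * x $ i)" by auto
        then show ?thesis by (simp only: real_form_scale)
      qed
    qed blast
    define b' where "b' i = b i - l" for i
    have b': "real_form m V b' c x = real_form m V b c x - l * (\<Sum>i\<in>V. x i ^ m)" for x
      unfolding b'_def by (rule form_shift_diag) simp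
    have psd': "0 \<le> real_form m V b' c x" for x
    proof -
      \<comment> \<open>The form sees only the coordinates in \<open>V\<close>; clearing the others
        brings \<open>x\<close> into the subspace where \<open>l\<close> is minimal.\<close>
      let ?x = "\<chi> i. if i \<in> V then x i else 0"
      have "real_form m V b c (($) ?x) = real_form m V b c x"
        by (rule form_cong) simp
      moreover have "(\<Sum>i\<in>V. (?x $ i) ^ m) = (\<Sum>i\<in>V. x i ^ m)" by simp
      ultimately show ?thesis using l[of ?x] by (simp add: b')
    qed
    define z where "z i = \<bar>z0 $ i\<bar>" for i
    have z_zero: "real_form m V b' c z = 0"
    proof (rule antisym)
      have "real_form m V b' c z \<le> real_form m V b' c (($) z0)"
        unfolding z_def by (rule real_form_abs_le[OF m(1) c])
      also have "\<dots> = 0" unfolding b' using z0(3) by simp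
      finally show "real_form m V b' c z \<le> 0" .
    qed (rule psd')
    define S where "S = {i\<in>V. z i \<noteq> 0}"
    have S: "S \<subseteq> V" "V - S = {i\<in>V. z i = 0}" by (auto simp: S_def)
    obtain j where j: "z0 $ j \<noteq> 0" using z0(1) by (auto simp: vec_eq_iff)
    then have "j \<in> V" using z0(2) by blast
    then have "j \<in> S" using j by (simp add: S_def z_def)
    have "form Const m V b' c y \<in> sos"
    proof (cases "S = V")
      case True
      then have "z i > 0" if "i \<in> V" for i using that by (auto simp: S_def z_def)
      then show ?thesis
        by (intro sos_form_interior_zero[OF m _ psd' z_zero] c)
    next
      case False
      have mixed: "c \<alpha> = 0" if "\<alpha> \<in> Omega m V" "\<not> Poly_Mapping.keys \<alpha> \<subseteq> S"
        "\<not> Poly_Mapping.keys \<alpha> \<subseteq> V - S" for \<alpha>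
        using that unfolding S(2) unfolding S_def
        by (intro real_form_mixed_zero[OF c psd' z_zero m(2)]) (auto simp: z_def)
      have split: "real_form m V b' c x = real_form m S b' c x + real_form m (V - S) b' c x" for x
        by (rule form_split[OF _ m(2) S(1) mixed]) auto
      \<comment> \<open>The support \<open>S\<close> of the zero is nonempty because of
        \<open>j\<close>, and it is proper in this case, so both parts are smaller than
        \<open>V\<close>.\<close>
      have card: "card S < card V" "card (V - S) < card V"
        using S(1) False \<open>j \<in> S\<close> by (auto intro!: psubset_card_mono)
      have "form Const m S b' c y \<in> sos"
        using S(1) by (intro less.hyps[OF card(1)] real_form_psd_restrict(1)[OF psd' m(2) S(1) split] c)
          (auto simp: Omega_def)
      moreover have "form Const m (V - S) b' c y \<in> sos"
        by (intro less.hyps[OF card(2)] real_form_psd_restrict(2)[OF psd' m(2) S(1) split] c)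
          (auto simp: Omega_def)
      moreover have "form Const m V b' c y = form Const m S b' c y + form Const m (V - S) b' c y"
        by (rule form_split) (auto intro: m mixed subsetD[OF S(1)])
      ultimately show ?thesis by (simp add: sos_add)
    qed
    moreover have "0 \<le> l"
    proof -
      have "0 < (\<Sum>i\<in>V. (z0 $ i) ^ m)"
        using sum_even_power_pos[of m V j "($) z0"] m(1) \<open>j \<in> V\<close> j by simp
      then show ?thesis using psd[of "($) z0"] z0(3) by (simp add: zero_le_mult_iff)
    qed
    then have "Const l * (\<Sum>i\<in>V. y i ^ m) \<in> sos"
      using m(1) by (intro sos_scale sos_sum sos_even_power)
    moreover have "form Const m V b c y = form Const m V b' c y + Const l * (\<Sum>i\<in>V. y i ^ m)"
      unfolding b'_def by (simp add: form_shift_diag Const_diff)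
    ultimately show ?thesis by (simp add: sos_add)
  qed
qed

text \<open>An off-diagonal monomial contains a variable other than \<open>i\<close>, for otherwise
  it would be the pure power of variable \<open>i\<close>.\<close>

lemma monom_at_Omega_unit:
  assumes "\<alpha> \<in> Omega m V" "m > 0"
  shows "monom_at \<alpha> (\<lambda>j. if j = i then 1 else 0) = 0"
proof -
  have "\<exists>j\<in>Poly_Mapping.keys \<alpha>. j \<noteq> i"
  proof (rule ccontr)
    assume "\<not> ?thesis"
    then have k: "Poly_Mapping.lookup \<alpha> j = 0" if "j \<noteq> i" for j
      using that by (auto simp: in_keys_iff)
    then have "mdegree \<alpha> = Poly_Mapping.lookup \<alpha> i"
      unfolding mdegree_def by (subst sum.remove[of _ i]) auto
    then have "\<alpha> = Poly_Mapping.single i m"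
      using k OmegaD(1)[OF assms(1)] by (intro poly_mapping_eqI) (auto simp: lookup_single when_def)
    then show False using OmegaD(3)[OF assms(1)] by blast
  qed
  then show ?thesis by (auto intro: monom_at_eq_0)
qed

lemma real_form_psd_diag_nonneg:
  assumes "\<And>x. 0 \<le> real_form m V b c x" "m > 0" "i \<in> V"
  shows "0 \<le> b i"
proof -
  have "(\<Sum>j\<in>V. b j * (if j = i then 1 else 0) ^ m) = (\<Sum>j\<in>V. if j = i then b j else 0)"
    using assms(2) by (intro sum.cong) auto
  then have "real_form m V b c (\<lambda>j. if j = i then 1 else 0) = b i"
    using assms(2,3) by (simp add: form_def monom_at_Omega_unit)
  then show ?thesis using assms(1) by metis
qed

lemma sos_monom_at_even:
  assumes "\<And>i. even (Poly_Mapping.lookup \<alpha> i)"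
  shows "monom_at \<alpha> y \<in> sos"
proof -
  have "monom_at \<alpha> y = (\<Prod>i\<in>UNIV. y i ^ (Poly_Mapping.lookup \<alpha> i div 2))\<^sup>2"
    unfolding monom_at_def prod_power_distrib using assms
    by (intro prod.cong) (simp_all flip: power_mult)
  then show ?thesis by (simp add: sos_square)
qed

text \<open>If some coefficient is positive, it is the only nonzero one off the diagonal. When all
  its exponents are even, every term of the form is a sum of squares. Otherwise changing the sign of
  a variable of odd exponent reduces to nonpositive coefficients.\<close>

theorem psd_extended_Z_block_sos:
  fixes y :: "'n::finite \<Rightarrow> 'v mpolynomial"
  assumes m: "even m" "m > 0"
    and Z: "(\<exists>\<beta>\<in>Omega m V. \<forall>\<alpha>\<in>Omega m V - {\<beta>}. c \<alpha> = 0) \<or> (\<forall>\<alpha>\<in>Omega m V. c \<alpha> \<le> 0)"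
    and psd: "\<And>x. 0 \<le> real_form m V b c x"
  shows "form Const m V b c y \<in> sos"
proof (cases "\<forall>\<alpha>\<in>Omega m V. c \<alpha> \<le> 0")
  case True
  then show ?thesis using psd_diagonal_minus_tail_sos[OF m _ psd] by blast
next
  case False
  then obtain \<beta> where \<beta>: "\<beta> \<in> Omega m V" "\<And>\<alpha>. \<alpha> \<in> Omega m V \<Longrightarrow> \<alpha> \<noteq> \<beta> \<Longrightarrow> c \<alpha> = 0" "c \<beta> > 0"
    using Z by (metis Diff_iff linorder_le_less_linear order_refl singletonD)
  show ?thesis
  proof (cases "\<forall>i. even (Poly_Mapping.lookup \<beta> i)")
    case True
    have "Const (c \<alpha>) * monom_at \<alpha> y \<in> sos" if "\<alpha> \<in> Omega m V" for \<alpha>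
      using \<beta> that True by (cases "\<alpha> = \<beta>") (auto intro: sos_scale sos_monom_at_even sos.zero less_imp_le)
    moreover have "Const (b i) * y i ^ m \<in> sos" if "i \<in> V" for i
      using real_form_psd_diag_nonneg[OF psd m(2) that] m(1) by (intro sos_scale sos_even_power)
    ultimately show ?thesis
      unfolding form_def by (intro sos_add sos_sum) auto
  next
    case False
    then obtain j where j: "odd (Poly_Mapping.lookup \<beta> j)" by blast
    \<comment> \<open>Stated for a general \<open>e\<close>, since it transfers both nonnegativity
      over the reals and the final polynomial identity.\<close>
    have reflect: "form e m V b c x = form e m V b (\<lambda>\<alpha>. - c \<alpha>) (x(j := - x j))"
      if "e 0 = 0" "\<And>r. e (- r) = - e r" for e :: "real \<Rightarrow> 'r::comm_ring_1" and x
    proof -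
      have "monom_at \<beta> (x(j := - x j)) = - monom_at \<beta> x"
        using monom_at_upd[of \<beta> x j "-1"] j by simp
      then have "e (- c \<alpha>) * monom_at \<alpha> (x(j := - x j)) = e (c \<alpha>) * monom_at \<alpha> x"
        if "\<alpha> \<in> Omega m V" for \<alpha>
        using that \<beta>(2)[OF that] \<open>e 0 = 0\<close> \<open>\<And>r. e (- r) = - e r\<close> by (cases "\<alpha> = \<beta>") auto
      moreover have "(x(j := - x j)) i ^ m = x i ^ m" for i
        using m(1) by simp
      ultimately show ?thesis by (simp add: form_def)
    qed
    have "form Const m V b (\<lambda>\<alpha>. - c \<alpha>) (y(j := - y j)) \<in> sos"
    proof (rule psd_diagonal_minus_tail_sos[OF m])
      show "- c \<alpha> \<le> 0" if "\<alpha> \<in> Omega m V" for \<alpha>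
        using \<beta> that by (cases "\<alpha> = \<beta>") auto
      show "0 \<le> real_form m V b (\<lambda>\<alpha>. - c \<alpha>) x" for x
        using psd[of "x(j := - x j)"] reflect[of "\<lambda>r. r" "x(j := - x j)"] by simp
    qed
    then show ?thesis using reflect[of Const y] by (simp add: Const_uminus)
  qed
qed

section \<open>Tensors and H-eigenvalues\<close>

lemma finite_lists_length: "finite {is :: 'n::finite list. length is = n}"
  using finite_lists_length_eq[of "UNIV :: 'n set" n] by simp

lemma symmetric_tensor_mset:
  assumes "symmetric_tensor m A" "mset xs = mset ys" "length ys = m"
  shows "A xs = A ys"
proof -
  obtain \<sigma> where "\<sigma> permutes {..<length ys}" "permute_list \<sigma> ys = xs"
    using mset_eq_permutation[OF assms(2)] by blast
  then show ?thesis using assms(1,3) by (auto simp: symmetric_tensor_def)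
qed

text \<open>The product rule along coordinate \<open>i\<close>: each position holding
  \<open>i\<close> contributes the product with that position deleted.\<close>

lemma DERIV_prod_list:
  fixes u :: "real \<Rightarrow> 'n \<Rightarrow> real"
  assumes "\<And>j. DERIV (\<lambda>t. u t j) 0 :> (if j = i then 1 else 0)"
  shows "DERIV (\<lambda>t. prod_list (map (u t) is)) 0 :>
    (\<Sum>k<length is. if is ! k = i then prod_list (map (u 0) (take k is @ drop (Suc k) is)) else 0)"
proof (induction "is")
  case (Cons a "is")
  show ?case
    unfolding length_Cons sum.lessThan_Suc_shift
    by (auto intro!: derivative_eq_intros assms Cons.IH sum.cong simp: sum_distrib_left algebra_simps)
qed simp

text \<open>Symmetry moves the index from slot \<open>k\<close> to the front, and deleting or
  inserting that slot is a bijection of index lists. All slots thus contribute equally, which yields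
  the factor \<open>m\<close> in \<open>DERIV_tensor_form\<close>.\<close>

lemma sum_symmetric_tensor_slot:
  fixes A :: "'n::finite tensor" and x :: "'n \<Rightarrow> real"
  assumes A: "symmetric_tensor m A" and k: "k < m"
  shows "(\<Sum>is | length is = m. if is ! k = i then A is * prod_list (map x (take k is @ drop (Suc k) is)) else 0)
    = (\<Sum>is | length is = m - 1. A (i # is) * prod_list (map x is))"
proof -
  have "(\<Sum>is | length is = m. if is ! k = i then A is * prod_list (map x (take k is @ drop (Suc k) is)) else 0)
    = (\<Sum>is | length is = m \<and> is ! k = i. A is * prod_list (map x (take k is @ drop (Suc k) is)))"
    by (simp add: sum.inter_filter[OF finite_lists_length, symmetric])
  also have "\<dots> = (\<Sum>is | length is = m - 1. A (i # is) * prod_list (map x is))"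
  proof (rule sum.reindex_bij_witness[where i = "\<lambda>is. take k is @ i # drop k is" and j = "\<lambda>is. take k is @ drop (Suc k) is"])
    fix "is" assume a: "is \<in> {is. length is = m \<and> is ! k = i}"
    then have dec: "is = take k is @ i # drop (Suc k) is" using k id_take_nth_drop[of k "is"] by auto
    show "take k (take k is @ drop (Suc k) is) @ i # drop k (take k is @ drop (Suc k) is) = is"
      using dec a k by simp
    show "take k is @ drop (Suc k) is \<in> {is. length is = m - 1}"
      using a k by simp
    have "A is = A (i # take k is @ drop (Suc k) is)"
      by (rule sym, rule symmetric_tensor_mset[OF A]) (use a in \<open>subst (3) dec, auto\<close>)
    then show "A (i # take k is @ drop (Suc k) is) * prod_list (map x (take k is @ drop (Suc k) is))
        = A is * prod_list (map x (take k is @ drop (Suc k) is))" by simp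
  next
    fix "is" :: "'n list" assume a: "is \<in> {is. length is = m - 1}"
    show "take k (take k is @ i # drop k is) @ drop (Suc k) (take k is @ i # drop k is) = is"
      using a k by simp
    show "take k is @ i # drop k is \<in> {is. length is = m \<and> is ! k = i}"
      using a k by (simp add: nth_append)
  qed
  finally show ?thesis .
qed

lemma DERIV_tensor_form:
  fixes A :: "'n::finite tensor"
  assumes "symmetric_tensor m A"
  shows "DERIV (\<lambda>t. tensor_form m A (x + t *\<^sub>R axis i 1)) 0 :>
    real m * (\<Sum>is | length is = m - 1. A (i # is) * prod_list (map (($) x) is))"
proof -
  let ?u = "\<lambda>t j. (x + t *\<^sub>R axis i 1) $ j"
  let ?P = "\<lambda>k is. prod_list (map (($) x) (take k is @ drop (Suc k) is))"
  have u: "DERIV (\<lambda>t. ?u t j) 0 :> (if j = i then 1 else 0)" for j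
    by (auto intro!: derivative_eq_intros simp: axis_def)
  have "DERIV (\<lambda>t. tensor_form m A (x + t *\<^sub>R axis i 1)) 0 :>
      (\<Sum>is | length is = m. A is * (\<Sum>k<length is. if is ! k = i then ?P k is else 0))"
    unfolding tensor_form_def
  proof (intro DERIV_sum DERIV_cmult)
    fix "is" :: "'n list"
    have "x + 0 *\<^sub>R axis i 1 = x" by simp
    then show "DERIV (\<lambda>t. prod_list (map (?u t) is)) 0 :> (\<Sum>k<length is. if is ! k = i then ?P k is else 0)"
      using DERIV_prod_list[of ?u i "is", OF u] by (simp only:)
  qed
  also have "(\<Sum>is | length is = m. A is * (\<Sum>k<length is. if is ! k = i then ?P k is else 0))
      = (\<Sum>is | length is = m. \<Sum>k<m. if is ! k = i then A is * ?P k is else 0)"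
    by (auto simp: sum_distrib_left intro!: sum.cong)
  also have "\<dots> = (\<Sum>k<m. \<Sum>is | length is = m. if is ! k = i then A is * ?P k is else 0)"
    by (rule sum.swap)
  also have "\<dots> = real m * (\<Sum>is | length is = m - 1. A (i # is) * prod_list (map (($) x) is))"
    using sum_symmetric_tensor_slot[OF assms] by simp
  finally show ?thesis .
qed

text \<open>Used to contract the eigenvalue equations with the eigenvector, which gives the value of
  the form there.\<close>

lemma tensor_form_first_slot:
  fixes A :: "'n::finite tensor"
  assumes "m > 0"
  shows "tensor_form m A x
    = (\<Sum>i\<in>UNIV. x $ i * (\<Sum>is | length is = m - 1. A (i # is) * prod_list (map (($) x) is)))"
proof -
  have "tensor_form m A x
      = (\<Sum>(i, is)\<in>UNIV \<times> {is. length is = m - 1}. x $ i * (A (i # is) * prod_list (map (($) x) is)))"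
    unfolding tensor_form_def
    by (rule sum.reindex_bij_witness[where i = "\<lambda>(i, is). i # is" and j = "\<lambda>is. (hd is, tl is)"])
       (use assms in \<open>auto simp: length_Suc_conv neq_Nil_conv elim: list.set_cases\<close>)
  then show ?thesis by (simp add: sum.cartesian_product[symmetric] sum_distrib_left)
qed

lemma tensor_form_scale: "tensor_form m A (t *\<^sub>R x) = t ^ m * tensor_form m A x"
proof -
  have "prod_list (map (\<lambda>i. (t *\<^sub>R x) $ i) is) = t ^ length is * prod_list (map (\<lambda>i. x $ i) is)" for "is"
    by (induction "is") auto
  then show ?thesis
    by (simp add: tensor_form_def sum_distrib_left algebra_simps)
qed

lemma continuous_tensor_form: "continuous_on UNIV (tensor_form m A)"
  unfolding poly_eval_tensor_poly[symmetric] poly_eval_def by (intro continuous_intros)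

text \<open>At a minimizer of the quotient of the form by the power sum, the vanishing partial
  derivatives are the eigenvalue equations. Conversely, every \<open>H\<close>-eigenvalue is the
  value of this quotient at its eigenvector, hence at least \<open>l\<close>.\<close>

lemma minimal_H_eigenvalue:
  fixes A :: "'n::finite tensor"
  assumes m: "even m" "m > 0" and A: "symmetric_tensor m A"
  obtains l z where "H_eigenvalue m A l" "\<And>l'. H_eigenvalue m A l' \<Longrightarrow> l \<le> l'"
    "\<And>x. l * (\<Sum>i\<in>UNIV. (x $ i) ^ m) \<le> tensor_form m A x"
    "(\<Sum>i\<in>UNIV. (z $ i) ^ m) = 1" "tensor_form m A z = l"
proof -
  obtain l and z :: "real ^ 'n" where z: "z \<noteq> 0" "tensor_form m A z = l * (\<Sum>i\<in>UNIV. (z $ i) ^ m)"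
    and l: "\<And>x. l * (\<Sum>i\<in>UNIV. (x $ i) ^ m) \<le> tensor_form m A x"
    by (rule homogeneous_minimum[OF m UNIV_not_empty continuous_tensor_form tensor_form_scale]) auto
  have pos: "(\<Sum>i\<in>UNIV. (x $ i) ^ m) > 0" if "x \<noteq> 0" for x :: "real ^ 'n"
    using that sum_even_power_pos[OF m(1), of UNIV _ "($) x"] by (auto simp: vec_eq_iff)
  have "(\<Sum>is | length is = m - 1. A (i # is) * prod_list (map (($) z) is)) = l * (z $ i) ^ (m - 1)" for i
  proof -
    define g where "g t = tensor_form m A (z + t *\<^sub>R axis i 1) - l * (\<Sum>j\<in>UNIV. ((z + t *\<^sub>R axis i 1) $ j) ^ m)" for t
    have "DERIV (\<lambda>t. ((z + t *\<^sub>R axis i 1) $ j) ^ m) 0 :> (if j = i then real m * (z $ i) ^ (m - 1) else 0)" for j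
      by (auto intro!: derivative_eq_intros simp: axis_def)
    then have "DERIV (\<lambda>t. \<Sum>j\<in>UNIV. ((z + t *\<^sub>R axis i 1) $ j) ^ m) 0 :>
        (\<Sum>j\<in>UNIV. if j = i then real m * (z $ i) ^ (m - 1) else 0)"
      by (rule DERIV_sum)
    also have "(\<Sum>j\<in>UNIV. if j = i then real m * (z $ i) ^ (m - 1) else 0) = real m * (z $ i) ^ (m - 1)"
      by simp
    finally have "DERIV g 0 :> real m * (\<Sum>is | length is = m - 1. A (i # is) * prod_list (map (($) z) is))
        - l * (real m * (z $ i) ^ (m - 1))"
      unfolding g_def by (intro DERIV_diff DERIV_cmult DERIV_tensor_form[OF A])
    moreover have "g 0 \<le> g t" for t
      using z(2) l[of "z + t *\<^sub>R axis i 1"] by (simp add: g_def)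
    ultimately have "real m * (\<Sum>is | length is = m - 1. A (i # is) * prod_list (map (($) z) is))
        - l * (real m * (z $ i) ^ (m - 1)) = 0"
      by (intro DERIV_local_min[of g _ 0 1]) simp_all
    then have "real m * (\<Sum>is | length is = m - 1. A (i # is) * prod_list (map (($) z) is))
        = real m * (l * (z $ i) ^ (m - 1))"
      by (simp only: mult.left_commute right_minus_eq)
    then show ?thesis using m(2) by simp
  qed
  then have "H_eigenvalue m A l" using z(1) unfolding H_eigenvalue_def by blast
  moreover have "l \<le> l'" if "H_eigenvalue m A l'" for l'
  proof -
    obtain x where x: "x \<noteq> 0"
      "\<And>i. (\<Sum>is | length is = m - 1. A (i # is) * prod_list (map (($) x) is)) = l' * (x $ i) ^ (m - 1)"
      using \<open>H_eigenvalue m A l'\<close> unfolding H_eigenvalue_def by blast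
    have "tensor_form m A x = (\<Sum>i\<in>UNIV. l' * ((x $ i) ^ (m - 1) * x $ i))"
      unfolding tensor_form_first_slot[OF m(2)] x(2) by (simp add: algebra_simps)
    also have "\<dots> = l' * (\<Sum>i\<in>UNIV. (x $ i) ^ m)"
      by (simp only: power_minus_mult[OF m(2)] sum_distrib_left)
    finally show ?thesis using l[of x] pos[OF x(1)] by simp
  qed
  moreover have "\<exists>w. (\<Sum>i\<in>UNIV. (w $ i) ^ m) = 1 \<and> tensor_form m A w = l"
  proof -
    let ?N = "\<Sum>i\<in>UNIV. (z $ i) ^ m"
    \<comment> \<open>Scaling the minimizer to power sum 1 gives the point at which the upper bound
      for \<open>\<mu>\<close> is read off in \<open>theorem5p1\<close>.\<close>
    define t where "t = inverse (root m ?N)"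
    have t: "t ^ m * ?N = 1"
      using pos[OF z(1)] m(2) by (simp add: t_def power_inverse)
    then have "tensor_form m A (t *\<^sub>R z) = l"
      by (simp add: tensor_form_scale z(2))
    moreover have "(\<Sum>i\<in>UNIV. ((t *\<^sub>R z) $ i) ^ m) = 1"
      using t by (simp add: power_mult_distrib sum_distrib_left)
    ultimately show ?thesis by blast
  qed
  ultimately show ?thesis using that l by blast
qed

section \<open>Forms in the variables as polynomials, and passage to \<open>SOS\<close>\<close>

lemma Var_power: "Var i ^ k = Poly_Mapping.single (Poly_Mapping.single i k) 1"
proof (induction k)
  case (Suc k)
  then show ?case by (simp add: Var_def mult_single single_add[symmetric])
qed simp

lemma Const_mult_Var_power: "Const r * Var i ^ k = Poly_Mapping.single (Poly_Mapping.single i k) r"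
  by (simp add: Var_power Const_def mult_single)

lemma single_eq_monom_at: "Poly_Mapping.single \<alpha> r = Const r * monom_at \<alpha> Var"
proof -
  have prod: "(\<Prod>i\<in>I. Poly_Mapping.single (g i) (1::real)) = Poly_Mapping.single (\<Sum>i\<in>I. g i) 1"
    for g :: "'a \<Rightarrow> 'a \<Rightarrow>\<^sub>0 nat" and I
    by (induction I rule: infinite_finite_induct) (simp_all add: mult_single)
  have "(\<Sum>i\<in>UNIV. Poly_Mapping.single i (Poly_Mapping.lookup \<alpha> i)) = \<alpha>"
    by (rule poly_mapping_eqI) (simp add: lookup_sum lookup_single when_def)
  then have "monom_at \<alpha> Var = Poly_Mapping.single \<alpha> 1"
    unfolding monom_at_def Var_power prod by (simp only:)
  then show ?thesis by (simp add: Const_def mult_single)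
qed

lemma lookup_form_Var:
  assumes "mdegree \<gamma> \<noteq> m"
  shows "Poly_Mapping.lookup (form Const m V b c Var) \<gamma> = 0"
proof -
  have "mdegree (Poly_Mapping.single i m) = m" for i :: 'a
    by (simp add: mdegree_def lookup_single when_def)
  then have "Poly_Mapping.single i m \<noteq> \<gamma>" for i using assms by metis
  moreover have "\<gamma> \<notin> Omega m V" using assms OmegaD(1) by blast
  ultimately show ?thesis
    unfolding form_def single_eq_monom_at[symmetric] Const_mult_Var_power
    by (simp add: lookup_add lookup_sum lookup_single when_def finite_Omega)
qed

lemma poly_eval_form_Var: "poly_eval (form Const m V b c Var) x = real_form m V b c (($) x)"
proof -
  have "poly_eval (monom_at \<alpha> Var) x = monom_at \<alpha> (($) x)" for \<alpha>
    using poly_eval_single[of \<alpha> 1 x] by (simp add: single_eq_monom_at) (simp add: monom_at_def)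
  then show ?thesis
    by (simp add: form_def poly_eval_add poly_eval_sum poly_eval_mult poly_eval_power)
qed

lemma SOS_poly_eval_nonneg: "p \<in> SOS d \<Longrightarrow> 0 \<le> poly_eval p x"
  by (auto simp: SOS_def poly_eval_sum poly_eval_power intro!: sum_nonneg)

text \<open>\<open>SOS d\<close> bounds the degree of the sum and not of the squares, so no
  cancellation argument on leading terms is required.\<close>

lemma SOS_of_sos:
  assumes "p \<in> sos" "\<And>\<gamma>. mdegree \<gamma> \<noteq> d \<Longrightarrow> Poly_Mapping.lookup p \<gamma> = 0"
  shows "p \<in> SOS d"
proof -
  have "mdegree \<gamma> \<le> d" if "\<gamma> \<in> Poly_Mapping.keys p" for \<gamma>
    using assms(2)[of \<gamma>] that by (auto simp: in_keys_iff)
  then have "poly_degree p \<le> d" by (simp add: poly_degree_def)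
  then show ?thesis
    using sos_imp_sum_of_squares[OF assms(1)] unfolding SOS_def by blast
qed

text \<open>Subtracting \<open>l\<close> times the power sum alters only diagonal coefficients. As
  the sets \<open>\<Gamma> k\<close> partition the variables, the difference is a sum of block forms
  in disjoint variables, and nonnegativity passes to each of them.\<close>

lemma psd_extended_Z_polynomial_shift_SOS:
  fixes f :: "'n::finite mpolynomial"
  assumes m: "even m" "m > 0" and Z: "extended_Z_polynomial m f"
    and psd: "\<And>x. l * (\<Sum>i\<in>UNIV. (x $ i) ^ m) \<le> poly_eval f x"
  shows "f - Const l * m_norm_poly m \<in> SOS m"
proof -
  define c where "c = Poly_Mapping.lookup f"
  define b where "b i = c (Poly_Mapping.single i m) - l" for i
  obtain s :: nat and \<Gamma> where
      cover: "(\<Union>k\<in>{1..s}. \<Gamma> k) = (UNIV :: 'n set)"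
    and disj: "\<And>k k'. k \<in> {1..s} \<Longrightarrow> k' \<in> {1..s} \<Longrightarrow> k \<noteq> k' \<Longrightarrow> \<Gamma> k \<inter> \<Gamma> k' = {}"
    and f: "f = (\<Sum>i\<in>UNIV. Const (c (Poly_Mapping.single i m)) * Var i ^ m)
        + (\<Sum>k\<in>{1..s}. \<Sum>\<alpha>\<in>Omega m (\<Gamma> k). Poly_Mapping.single \<alpha> (c \<alpha>))"
    and block: "\<And>k. k \<in> {1..s} \<Longrightarrow>
        (\<exists>\<beta>\<in>Omega m (\<Gamma> k). \<forall>\<alpha>\<in>Omega m (\<Gamma> k) - {\<beta>}. c \<alpha> = 0) \<or> (\<forall>\<alpha>\<in>Omega m (\<Gamma> k). c \<alpha> \<le> 0)"
    using Z unfolding extended_Z_polynomial_def c_def[symmetric]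
  proof (elim exE conjE, goal_cases)
    case (1 s \<Gamma>)
    show ?case
      by (rule 1(1)[OF 1(3) _ 1(5)]) ((rule 1(4)[rule_format]; assumption), erule bspec[OF 1(6)])
  qed
  let ?B = "\<lambda>k. form Const m (\<Gamma> k) b c Var"
  have "(\<Sum>i\<in>UNIV. Const (b i) * Var i ^ m) = (\<Sum>k\<in>{1..s}. \<Sum>i\<in>\<Gamma> k. Const (b i) * Var i ^ m)"
    unfolding cover[symmetric] by (rule sum.UNION_disjoint) (use disj in auto)
  moreover have "f - Const l * m_norm_poly m = (\<Sum>i\<in>UNIV. Const (b i) * Var i ^ m)
        + (\<Sum>k\<in>{1..s}. \<Sum>\<alpha>\<in>Omega m (\<Gamma> k). Poly_Mapping.single \<alpha> (c \<alpha>))"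
    by (subst f) (simp add: b_def m_norm_poly_def Const_diff left_diff_distrib sum_subtractf sum_distrib_left)
  ultimately have eq: "f - Const l * m_norm_poly m = (\<Sum>k\<in>{1..s}. ?B k)"
    by (simp add: form_def sum.distrib single_eq_monom_at)
  have block_psd: "0 \<le> real_form m (\<Gamma> k) b c x" if k: "k \<in> {1..s}" for k x
  proof -
    \<comment> \<open>At \<open>x'\<close> every block other than \<open>k\<close> vanishes.\<close>
    define x' :: "real ^ 'n" where "x' = (\<chi> i. if i \<in> \<Gamma> k then x i else 0)"
    have "0 \<le> poly_eval (f - Const l * m_norm_poly m) x'"
      using psd[of x'] by (simp add: poly_eval_diff poly_eval_mult m_norm_poly_def poly_eval_sum poly_eval_power)
    also have "\<dots> = (\<Sum>j\<in>{1..s}. real_form m (\<Gamma> j) b c (($) x'))"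
      unfolding eq by (simp add: poly_eval_sum poly_eval_form_Var)
    also have "\<dots> = (\<Sum>j\<in>{1..s}. if j = k then real_form m (\<Gamma> k) b c (($) x') else 0)"
    proof (rule sum.cong[OF refl])
      fix j assume j: "j \<in> {1..s}"
      have "x' $ i = 0" if "j \<noteq> k" "i \<in> \<Gamma> j" for i
        using disj[OF j k] that by (auto simp: x'_def)
      then show "real_form m (\<Gamma> j) b c (($) x') = (if j = k then real_form m (\<Gamma> k) b c (($) x') else 0)"
        using form_zero[OF m(2), of "\<Gamma> j" "($) x'"] by auto
    qed
    also have "\<dots> = real_form m (\<Gamma> k) b c (($) x')"
      using k by simp
    also have "\<dots> = real_form m (\<Gamma> k) b c x"
      by (rule form_cong) (simp add: x'_def)
    finally show ?thesis .
  qed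
  show ?thesis
    unfolding eq
  proof (rule SOS_of_sos)
    show "(\<Sum>k\<in>{1..s}. ?B k) \<in> sos"
      by (intro sos_sum psd_extended_Z_block_sos m block block_psd)
  qed (simp add: lookup_sum lookup_form_Var)
qed

theorem theorem5p1:
  fixes m :: nat and A :: "'n::finite tensor"
  assumes "even m" and "m > 0"
    and "symmetric_tensor m A"
    and "extended_Z_tensor m A"
  shows "is_minimum {l. H_eigenvalue m A l} (lambda_min m A) \<and>
         is_maximum {\<mu>. \<exists>r. tensor_poly m A - Const r * (m_norm_poly m - 1) - Const \<mu> \<in> SOS m}
           (lambda_min m A)"
proof -
  obtain l z where l: "H_eigenvalue m A l" "\<And>l'. H_eigenvalue m A l' \<Longrightarrow> l \<le> l'"
    "\<And>x. l * (\<Sum>i\<in>UNIV. (x $ i) ^ m) \<le> tensor_form m A x"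
    and z: "(\<Sum>i\<in>UNIV. (z $ i) ^ m) = 1" "tensor_form m A z = l"
    using minimal_H_eigenvalue[OF assms(1-3)] by blast
  have lambda: "lambda_min m A = l"
    unfolding lambda_min_def using l(1,2) by (rule Least_equality)
  \<comment> \<open>With \<open>r = \<mu> = l\<close> the constant terms cancel, so the maximum is
    attained by a homogeneous polynomial.\<close>
  have "tensor_poly m A - Const l * (m_norm_poly m - 1) - Const l = tensor_poly m A - Const l * m_norm_poly m"
    by (simp add: algebra_simps)
  also have "\<dots> \<in> SOS m"
    using assms(4) l(3)
    by (intro psd_extended_Z_polynomial_shift_SOS assms)
       (simp_all add: extended_Z_tensor_def poly_eval_tensor_poly)
  finally have "tensor_poly m A - Const l * (m_norm_poly m - 1) - Const l \<in> SOS m" .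
  \<comment> \<open>At the normalized minimizer \<open>z\<close> the term with \<open>r\<close>
    vanishes, and nonnegativity reads \<open>l - \<mu> \<ge> 0\<close>.\<close>
  moreover have "\<mu> \<le> l" if "tensor_poly m A - Const r * (m_norm_poly m - 1) - Const \<mu> \<in> SOS m" for \<mu> r
    using SOS_poly_eval_nonneg[OF that, of z] z
    by (simp add: poly_eval_diff poly_eval_mult poly_eval_tensor_poly m_norm_poly_def poly_eval_sum poly_eval_power)
  ultimately show ?thesis
    using l(1,2) by (auto simp: lambda is_minimum_def is_maximum_def)
qed

end
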